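(* Let $(M,\varphi,\zeta,\eta,\langle\cdot,\cdot\rangle)$ be a connected almost contact metric manifold of dimension $2n+1$, $n>1$, with intrinsic torsion $\xi$ having components $\xi_{(1)},\dots,\xi_{(12)}$. If the structure is of type $\mathcal C_1\oplus\mathcal C_2\oplus\mathcal C_3\oplus\mathcal C_5\oplus\mathcal C_6\oplus\mathcal C_8\oplus\mathcal C_9\oplus\mathcal C_{11}$ with $(\xi_{(5)},\xi_{(6)})\neq(0,0)$, then it is of type $\mathcal C_1\oplus\mathcal C_2\oplus\mathcal C_3\oplus\mathcal C_5\oplus\mathcal C_8\oplus\mathcal C_9\oplus\mathcal C_{11}$ or of type $\mathcal C_2\oplus\mathcal C_6\oplus\mathcal C_9$.
   Context: Almost contact metric manifold: a $(2n+1)$-dimensional smooth manifold $M$ with a $(1,1)$-tensor $\varphi$, a vector field $\zeta$ (Reeb vector field), a one-form $\eta$ and a Riemannian metric $\langle\cdot,\cdot\rangle$ such that $\varphi^2=-I+\eta\otimes\zeta$, $\eta(\zeta)=1$, $\langle\varphi X,\varphi Y\rangle=\langle X,Y\rangle-\eta(X)\eta(Y)$. Then $\varphi\zeta=0$, $\eta\circ\varphi=0$, $\eta=\langle\zeta,\cdot\rangle$. The fundamental two-form is $F(X,Y)=\langle X,\varphi Y\rangle$. $\nabla$ is the Levi-Civita connection; $d^*$ is the coderivative, $d^*\alpha=-\sum_{i=1}^{2n+1}(\nabla_{e_i}\alpha)(e_i,\cdot,\dots)$ for a local orthonormal frame. Intrinsic torsion: $\xi_X=-\frac12\varphi\circ\nabla_X\varphi+\nabla_X\eta\otimes\zeta-\frac12\eta\otimes\nabla_X\zeta$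 (a skew-symmetric endomorphism for each $X$). $\xi_X$ acts on tensors as a derivation, so $(\xi_X\eta)(Y)=-\eta(\xi_XY)=\langle\xi_X\zeta,Y\rangle$ and $\xi_X\eta=-\nabla_X\eta$. Components $\xi=\sum_{i=1}^{12}\xi_{(i)}$, $\xi_{(i)}\in\mathcal C_i$ (Chinea–González-Dávila). Let $H=\zeta^\perp$, let $X_H=X-\eta(X)\zeta$, and let $e_1,\dots,e_{2n}$ be an orthonormal basis of $H$. - $\xi_{(11)}$: $(\xi_{(11)})_XY=\eta(X)(\xi_\zeta Y_H)_H$. - $\xi_{(12)}$: $(\xi_{(12)})_XY=\eta(X)\big(\eta(Y)\xi_\zeta\zeta-\langle\xi_\zeta\zeta,Y\rangle\zeta\big)$. - $\xi_{(5)},\dots,\xi_{(10)}$: let $B(X,Y)=(\xi_{X_H}\eta)(Y_H)$, a bilinear form on $H$. Write $B=B_5+B_8+B_9+B_6+B_7+B_{10}$, where $B_5$ is a multiple of $\langle\cdot,\cdot\rangle|_H$; $B_8$ is symmetric, $\varphi$-invariant ($B_8(\varphi X,\varphi Y)=B_8(X,Y)$) and trace-free; $B_9$ is symmetric with $B_9(\varphi X,\varphi Y)=-B_9(X,Y)$; $B_6$ is a multiple of $F|_H$; $B_7$ is skew, $\varphi$-invariant and orthogonal to $F$; $B_{10}$ is skew with $B_{10}(\varphi X,\varphi Y)=-B_{10}(X,Y)$. Then $\xi_{(i)}$ ($5\le i\le 10$) is determined by $(\xi_{(i)X}\eta)(Y)=B_i(X_H,Y_H)$, i.e. $\langle\xi_{(i)X}Y,Z\rangle=\eta(Y)B_i(X_H,Z_H)-\eta(Z)B_i(X_H,Y_H)$.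 Explicitly $B_5=\frac{d^*\eta}{2n}\langle\cdot,\cdot\rangle|_H$ and $B_6=-\frac{d^*F(\zeta)}{2n}F|_H$. - $\xi_{(1)},\dots,\xi_{(4)}$: the part $(\xi_{X_H}Y_H)_H$, regarded as $T(X,Y,Z)=\langle\xi_XY,Z\rangle$ on $H$ (skew in $Y,Z$, with $T(X,\varphi Y,\varphi Z)=-T(X,Y,Z)$), is the sum of Gray–Hervella components: $\mathcal C_1$: $T$ totally skew; $\mathcal C_2$: $T(\varphi X,\varphi Y,Z)=-T(X,Y,Z)$ and the cyclic sum of $T$ vanishes; $\mathcal C_3$: $T(\varphi X,\varphi Y,Z)=T(X,Y,Z)$ and $\sum_{i=1}^{2n}T(e_i,e_i,\cdot)=0$; $\mathcal C_4$: tensors of the form $4T(X,Y,Z)=\langle X,Y\rangle\theta(Z)-\theta(Y)\langle X,Z\rangle-\langle\varphi X,Y\rangle\langle\varphi\theta^\sharp,Z\rangle+\langle\varphi\theta^\sharp,Y\rangle\langle\varphi X,Z\rangle$ with $\theta\in H^*$ and $\theta^\sharp$ its metric dual vector. The structure is said to be of type $\bigoplus_{i\in I}\mathcal C_i$ if $\xi_{(i)}=0$ on $M$ for all $i\notin I$. *)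

theory Defs
  imports "HOL-Analysis.Analysis"
begin

section \<open>Smooth maps between open subsets of Euclidean spaces\<close>

text \<open>Only used for open \<open>S\<close> in a finite-dimensional space, where having directional derivatives
  of class \<open>C^k\<close> in all directions is the usual notion of class \<open>C^(k+1)\<close>.\<close>

primrec C_k_on :: "nat \<Rightarrow> 'a::real_normed_vector set \<Rightarrow> ('a \<Rightarrow> 'b::real_normed_vector) \<Rightarrow> bool" where
  "C_k_on 0 S f \<longleftrightarrow> continuous_on S f"
| "C_k_on (Suc k) S f \<longleftrightarrow>
     (\<forall>x\<in>S. f differentiable (at x)) \<and> (\<forall>v. C_k_on k S (\<lambda>x. frechet_derivative f (at x) v))"

definition smooth_on :: "'a::real_normed_vector set \<Rightarrow> ('a \<Rightarrow> 'b::real_normed_vector) \<Rightarrow> bool" where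
  "smooth_on S f \<longleftrightarrow> (\<forall>k. C_k_on k S f)"


section \<open>Smooth manifolds\<close>

text \<open>A chart is a pair of its domain and its coordinate map; the coordinate map is only relevant
  on the domain.  The atlas need not be maximal: any atlas determines the smooth structure.\<close>

type_synonym ('m, 'e) chart = "'m set \<times> ('m \<Rightarrow> 'e)"

definition coords :: "('m, 'e) chart \<Rightarrow> 'e set" where
  "coords c = snd c ` fst c"

definition overlap :: "('m, 'e) chart \<Rightarrow> ('m, 'e) chart \<Rightarrow> 'e set" where
  "overlap c c' = snd c ` (fst c \<inter> fst c')"

definition transition :: "('m, 'e) chart \<Rightarrow> ('m, 'e) chart \<Rightarrow> 'e \<Rightarrow> 'e" where
  "transition c c' = snd c' \<circ> inv_into (fst c) (snd c)"

locale smooth_manifold =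
  fixes M :: "'m topology"
    and A :: "('m, 'e::euclidean_space) chart set"
  assumes hausdorff: "Hausdorff_space M"
    and second_countable: "second_countable M"
    and chart_domain_open: "c \<in> A \<Longrightarrow> openin M (fst c)"
    and chart_coords_open: "c \<in> A \<Longrightarrow> open (coords c)"
    and chart_homeomorphic:
      "c \<in> A \<Longrightarrow> homeomorphic_map (subtopology M (fst c)) (top_of_set (coords c)) (snd c)"
    and charts_cover: "(\<Union>c\<in>A. fst c) = topspace M"
    and charts_compatible:
      "c \<in> A \<Longrightarrow> c' \<in> A \<Longrightarrow> smooth_on (overlap c c') (transition c c')"


section \<open>Almost contact metric structures\<close>

text \<open>The pointwise structure, on a tangent space (in a chart: on \<open>'e\<close>).  The inner product is
  \<open>g\<close>, not the inner product that \<open>'e\<close> carries as a Euclidean space.\<close>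

locale almost_contact_metric_vector_space =
  fixes \<phi> :: "'e::euclidean_space \<Rightarrow> 'e"
    and \<zeta> :: 'e
    and \<eta> :: "'e \<Rightarrow> real"
    and g :: "'e \<Rightarrow> 'e \<Rightarrow> real"
  assumes linear_\<phi>: "linear \<phi>"
    and linear_\<eta>: "linear \<eta>"
    and bilinear_g: "bilinear g"
    and g_symmetric: "g X Y = g Y X"
    and g_positive: "X \<noteq> 0 \<Longrightarrow> g X X > 0"
    and \<phi>_\<phi>: "\<phi> (\<phi> X) = - X + \<eta> X *\<^sub>R \<zeta>"
    and \<eta>_\<zeta>: "\<eta> \<zeta> = 1"
    and g_\<phi>_\<phi>: "g (\<phi> X) (\<phi> Y) = g X Y - \<eta> X * \<eta> Y"

text \<open>A tensor field on the manifold is given by its representatives in the charts, as a family of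
  functions of \<open>c \<in> A\<close> and of the coordinate vector \<open>x \<in> coords c\<close> that obeys the transformation
  law of its type; a tangent vector is represented in the chart \<open>c\<close> by its vector of components
  in \<open>'e\<close>.  Values at other \<open>c\<close> and \<open>x\<close> are irrelevant.\<close>

locale almost_contact_metric_manifold = smooth_manifold M A
  for M :: "'m topology" and A :: "('m, 'e::euclidean_space) chart set" +
  fixes \<phi> :: "('m, 'e) chart \<Rightarrow> 'e \<Rightarrow> 'e \<Rightarrow> 'e"
    and \<zeta> :: "('m, 'e) chart \<Rightarrow> 'e \<Rightarrow> 'e"
    and \<eta> :: "('m, 'e) chart \<Rightarrow> 'e \<Rightarrow> 'e \<Rightarrow> real"
    and g :: "('m, 'e) chart \<Rightarrow> 'e \<Rightarrow> 'e \<Rightarrow> 'e \<Rightarrow> real"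
  assumes pointwise: "c \<in> A \<Longrightarrow> x \<in> coords c \<Longrightarrow>
      almost_contact_metric_vector_space (\<phi> c x) (\<zeta> c x) (\<eta> c x) (g c x)"
    and smooth_\<phi>: "c \<in> A \<Longrightarrow> smooth_on (coords c) (\<lambda>x. \<phi> c x v)"
    and smooth_\<zeta>: "c \<in> A \<Longrightarrow> smooth_on (coords c) (\<zeta> c)"
    and smooth_\<eta>: "c \<in> A \<Longrightarrow> smooth_on (coords c) (\<lambda>x. \<eta> c x v)"
    and smooth_g: "c \<in> A \<Longrightarrow> smooth_on (coords c) (\<lambda>x. g c x v w)"
    and transform_\<phi>: "\<lbrakk>c \<in> A; c' \<in> A; x \<in> overlap c c';
        J = frechet_derivative (transition c c') (at x)\<rbrakk> \<Longrightarrow>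
        \<phi> c' (transition c c' x) (J v) = J (\<phi> c x v)"
    and transform_\<zeta>: "\<lbrakk>c \<in> A; c' \<in> A; x \<in> overlap c c';
        J = frechet_derivative (transition c c') (at x)\<rbrakk> \<Longrightarrow>
        \<zeta> c' (transition c c' x) = J (\<zeta> c x)"
    and transform_\<eta>: "\<lbrakk>c \<in> A; c' \<in> A; x \<in> overlap c c';
        J = frechet_derivative (transition c c') (at x)\<rbrakk> \<Longrightarrow>
        \<eta> c' (transition c c' x) (J v) = \<eta> c x v"
    and transform_g: "\<lbrakk>c \<in> A; c' \<in> A; x \<in> overlap c c';
        J = frechet_derivative (transition c c') (at x)\<rbrakk> \<Longrightarrow>
        g c' (transition c c' x) (J v) (J w) = g c x v w"


section \<open>Levi-Civita connection and intrinsic torsion\<close>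

text \<open>In this section \<open>g\<close>, \<open>\<phi>\<close>, \<open>\<zeta>\<close>, \<open>\<eta>\<close> are the representatives in one fixed chart.
  A connection is given by its Christoffel symbols, \<open>\<nabla>\<^sub>X Y = D\<^sub>X Y + \<Gamma>(X, Y)\<close>; it is torsion-free
  iff \<open>\<Gamma>\<close> is symmetric, and metric iff \<open>D\<^sub>X (g(Y, Z)) = g(\<Gamma>(X, Y), Z) + g(Y, \<Gamma>(X, Z))\<close> for
  constant \<open>Y\<close>, \<open>Z\<close>.\<close>

definition levi_civita ::
  "('e::euclidean_space \<Rightarrow> 'e \<Rightarrow> 'e \<Rightarrow> real) \<Rightarrow> 'e \<Rightarrow> 'e \<Rightarrow> 'e \<Rightarrow> 'e" where
  "levi_civita g x = (THE \<Gamma>. bilinear \<Gamma> \<and>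
     (\<forall>X Y. \<Gamma> X Y = \<Gamma> Y X) \<and>
     (\<forall>X Y Z. frechet_derivative (\<lambda>y. g y Y Z) (at x) X = g x (\<Gamma> X Y) Z + g x Y (\<Gamma> X Z)))"

text \<open>\<open>(\<nabla>\<^sub>X V)\<close>, \<open>(\<nabla>\<^sub>X \<alpha>)(Y)\<close> and \<open>(\<nabla>\<^sub>X P)(Y)\<close> at \<open>x\<close>, for a vector field \<open>V\<close>,
  a one-form \<open>\<alpha>\<close> and an endomorphism field \<open>P\<close>.\<close>

definition nabla_vector ::
  "('e::euclidean_space \<Rightarrow> 'e \<Rightarrow> 'e \<Rightarrow> real) \<Rightarrow> ('e \<Rightarrow> 'e) \<Rightarrow> 'e \<Rightarrow> 'e \<Rightarrow> 'e" where
  "nabla_vector g V x X = frechet_derivative V (at x) X + levi_civita g x X (V x)"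

definition nabla_form ::
  "('e::euclidean_space \<Rightarrow> 'e \<Rightarrow> 'e \<Rightarrow> real) \<Rightarrow> ('e \<Rightarrow> 'e \<Rightarrow> real) \<Rightarrow> 'e \<Rightarrow> 'e \<Rightarrow> 'e \<Rightarrow> real" where
  "nabla_form g \<alpha> x X Y =
     frechet_derivative (\<lambda>y. \<alpha> y Y) (at x) X - \<alpha> x (levi_civita g x X Y)"

definition nabla_endo ::
  "('e::euclidean_space \<Rightarrow> 'e \<Rightarrow> 'e \<Rightarrow> real) \<Rightarrow> ('e \<Rightarrow> 'e \<Rightarrow> 'e) \<Rightarrow> 'e \<Rightarrow> 'e \<Rightarrow> 'e \<Rightarrow> 'e" where
  "nabla_endo g P x X Y =
     frechet_derivative (\<lambda>y. P y Y) (at x) X + levi_civita g x X (P x Y) - P x (levi_civita g x X Y)"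

definition intrinsic_torsion ::
  "('e::euclidean_space \<Rightarrow> 'e \<Rightarrow> 'e) \<Rightarrow> ('e \<Rightarrow> 'e) \<Rightarrow> ('e \<Rightarrow> 'e \<Rightarrow> real) \<Rightarrow>
   ('e \<Rightarrow> 'e \<Rightarrow> 'e \<Rightarrow> real) \<Rightarrow> 'e \<Rightarrow> 'e \<Rightarrow> 'e \<Rightarrow> 'e" where
  "intrinsic_torsion \<phi> \<zeta> \<eta> g x X Y =
     - (1/2) *\<^sub>R \<phi> x (nabla_endo g \<phi> x X Y)
     + nabla_form g \<eta> x X Y *\<^sub>R \<zeta> x
     - (1/2) *\<^sub>R (\<eta> x Y *\<^sub>R nabla_vector g \<zeta> x X)"


section \<open>Components of the intrinsic torsion\<close>

context almost_contact_metric_vector_space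
begin

definition H :: "'e set" where
  "H = {X. g \<zeta> X = 0}"

definition hor :: "'e \<Rightarrow> 'e" where
  "hor X = X - \<eta> X *\<^sub>R \<zeta>"

definition F :: "'e \<Rightarrow> 'e \<Rightarrow> real" where
  "F X Y = g X (\<phi> Y)"

definition orthonormal_basis_H :: "'e set \<Rightarrow> bool" where
  "orthonormal_basis_H E \<longleftrightarrow> finite E \<and> E \<subseteq> H \<and> H \<subseteq> span E \<and>
     (\<forall>e\<in>E. \<forall>f\<in>E. g e f = (if e = f then 1 else 0))"

text \<open>The classes of bilinear forms on \<open>H\<close>.  A bilinear form on \<open>H\<close> is represented by one on the
  whole space, whose values outside \<open>H\<close> are never used.\<close>

definition sym_on_H :: "('e \<Rightarrow> 'e \<Rightarrow> real) \<Rightarrow> bool" where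
  "sym_on_H B \<longleftrightarrow> (\<forall>X\<in>H. \<forall>Y\<in>H. B X Y = B Y X)"

definition skew_on_H :: "('e \<Rightarrow> 'e \<Rightarrow> real) \<Rightarrow> bool" where
  "skew_on_H B \<longleftrightarrow> (\<forall>X\<in>H. \<forall>Y\<in>H. B X Y = - B Y X)"

definition \<phi>_invariant_on_H :: "('e \<Rightarrow> 'e \<Rightarrow> real) \<Rightarrow> bool" where
  "\<phi>_invariant_on_H B \<longleftrightarrow> (\<forall>X\<in>H. \<forall>Y\<in>H. B (\<phi> X) (\<phi> Y) = B X Y)"

definition \<phi>_anti_invariant_on_H :: "('e \<Rightarrow> 'e \<Rightarrow> real) \<Rightarrow> bool" where
  "\<phi>_anti_invariant_on_H B \<longleftrightarrow> (\<forall>X\<in>H. \<forall>Y\<in>H. B (\<phi> X) (\<phi> Y) = - B X Y)"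

definition B5_class :: "('e \<Rightarrow> 'e \<Rightarrow> real) set" where
  "B5_class = {B. bilinear B \<and> (\<exists>a. \<forall>X\<in>H. \<forall>Y\<in>H. B X Y = a * g X Y)}"

definition B6_class :: "('e \<Rightarrow> 'e \<Rightarrow> real) set" where
  "B6_class = {B. bilinear B \<and> (\<exists>a. \<forall>X\<in>H. \<forall>Y\<in>H. B X Y = a * F X Y)}"

definition B7_class :: "('e \<Rightarrow> 'e \<Rightarrow> real) set" where
  "B7_class = {B. bilinear B \<and> skew_on_H B \<and> \<phi>_invariant_on_H B \<and>
     (\<forall>E. orthonormal_basis_H E \<longrightarrow> (\<Sum>e\<in>E. \<Sum>f\<in>E. B e f * F e f) = 0)}"

definition B8_class :: "('e \<Rightarrow> 'e \<Rightarrow> real) set" where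
  "B8_class = {B. bilinear B \<and> sym_on_H B \<and> \<phi>_invariant_on_H B \<and>
     (\<forall>E. orthonormal_basis_H E \<longrightarrow> (\<Sum>e\<in>E. B e e) = 0)}"

definition B9_class :: "('e \<Rightarrow> 'e \<Rightarrow> real) set" where
  "B9_class = {B. bilinear B \<and> sym_on_H B \<and> \<phi>_anti_invariant_on_H B}"

definition B10_class :: "('e \<Rightarrow> 'e \<Rightarrow> real) set" where
  "B10_class = {B. bilinear B \<and> skew_on_H B \<and> \<phi>_anti_invariant_on_H B}"

text \<open>The Gray-Hervella classes, in the space of tensors \<open>S\<close> with
  \<open>\<langle>S\<^sub>X Y, Z\<rangle> = T(X\<^sub>H, Y\<^sub>H, Z\<^sub>H)\<close>, where \<open>T\<close> is a trilinear form on \<open>H\<close>, skew in the last two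
  arguments and with \<open>T(X, \<phi> Y, \<phi> Z) = - T(X, Y, Z)\<close>.\<close>

definition GH_space :: "('e \<Rightarrow> 'e \<Rightarrow> 'e) set" where
  "GH_space = {S. bilinear S \<and>
     (\<forall>X Y. S X Y = hor (S (hor X) (hor Y))) \<and>
     (\<forall>X\<in>H. \<forall>Y\<in>H. \<forall>Z\<in>H. g (S X Y) Z = - g (S X Z) Y) \<and>
     (\<forall>X\<in>H. \<forall>Y\<in>H. \<forall>Z\<in>H. g (S X (\<phi> Y)) (\<phi> Z) = - g (S X Y) Z)}"

definition GH1_class :: "('e \<Rightarrow> 'e \<Rightarrow> 'e) set" where
  "GH1_class = {S \<in> GH_space. \<forall>X\<in>H. \<forall>Y\<in>H. \<forall>Z\<in>H.
     g (S X Y) Z = - g (S Y X) Z \<and> g (S X Y) Z = - g (S X Z) Y}"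

definition GH2_class :: "('e \<Rightarrow> 'e \<Rightarrow> 'e) set" where
  "GH2_class = {S \<in> GH_space. \<forall>X\<in>H. \<forall>Y\<in>H. \<forall>Z\<in>H.
     g (S (\<phi> X) (\<phi> Y)) Z = - g (S X Y) Z \<and>
     g (S X Y) Z + g (S Y Z) X + g (S Z X) Y = 0}"

definition GH3_class :: "('e \<Rightarrow> 'e \<Rightarrow> 'e) set" where
  "GH3_class = {S \<in> GH_space.
     (\<forall>X\<in>H. \<forall>Y\<in>H. \<forall>Z\<in>H. g (S (\<phi> X) (\<phi> Y)) Z = g (S X Y) Z) \<and>
     (\<forall>E. orthonormal_basis_H E \<longrightarrow> (\<forall>Z\<in>H. (\<Sum>e\<in>E. g (S e e) Z) = 0))}"

definition GH4_class :: "('e \<Rightarrow> 'e \<Rightarrow> 'e) set" where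
  "GH4_class = {S \<in> GH_space. \<exists>\<theta> t. linear \<theta> \<and> t \<in> H \<and> (\<forall>X\<in>H. \<theta> X = g t X) \<and>
     (\<forall>X\<in>H. \<forall>Y\<in>H. \<forall>Z\<in>H. 4 * g (S X Y) Z =
        g X Y * \<theta> Z - \<theta> Y * g X Z - g (\<phi> X) Y * g (\<phi> t) Z + g (\<phi> t) Y * g (\<phi> X) Z)}"

text \<open>\<open>\<Xi> 1, \<dots>, \<Xi> 12\<close> are the components \<open>\<xi>\<^sub>(\<^sub>i\<^sub>)\<close> of \<open>\<xi>\<close>; the first conjunct concerns the part
  \<open>(\<xi>\<^bsub>X_H\<^esub> Y\<^sub>H)\<^sub>H\<close>, the second the form \<open>(\<xi>\<^bsub>X_H\<^esub> \<eta>)(Y\<^sub>H) = - \<eta>(\<xi>\<^bsub>X_H\<^esub> Y\<^sub>H)\<close>.  Since the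
  classes are in direct sum, the components are determined by \<open>\<xi>\<close>.\<close>

definition torsion_components :: "('e \<Rightarrow> 'e \<Rightarrow> 'e) \<Rightarrow> (nat \<Rightarrow> 'e \<Rightarrow> 'e \<Rightarrow> 'e) \<Rightarrow> bool" where
  "torsion_components \<xi> \<Xi> \<longleftrightarrow>
     (\<Xi> 1 \<in> GH1_class \<and> \<Xi> 2 \<in> GH2_class \<and> \<Xi> 3 \<in> GH3_class \<and> \<Xi> 4 \<in> GH4_class \<and>
      (\<forall>X Y. hor (\<xi> (hor X) (hor Y)) = (\<Sum>i=1..4. \<Xi> i X Y))) \<and>
     (\<exists>B. B 5 \<in> B5_class \<and> B 6 \<in> B6_class \<and> B 7 \<in> B7_class \<and>
          B 8 \<in> B8_class \<and> B 9 \<in> B9_class \<and> B 10 \<in> B10_class \<and>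
          (\<forall>X Y. - \<eta> (\<xi> (hor X) (hor Y)) = (\<Sum>i=5..10. B i (hor X) (hor Y))) \<and>
          (\<forall>i\<in>{5..10}. \<forall>X Y Z. g (\<Xi> i X Y) Z =
             \<eta> Y * B i (hor X) (hor Z) - \<eta> Z * B i (hor X) (hor Y))) \<and>
     (\<forall>X Y. \<Xi> 11 X Y = \<eta> X *\<^sub>R hor (\<xi> \<zeta> (hor Y))) \<and>
     (\<forall>X Y. \<Xi> 12 X Y = \<eta> X *\<^sub>R (\<eta> Y *\<^sub>R \<xi> \<zeta> \<zeta> - g (\<xi> \<zeta> \<zeta>) Y *\<^sub>R \<zeta>))"

end

definition intrinsic_torsion_components where
  "intrinsic_torsion_components A \<phi> \<zeta> \<eta> g \<Xi> \<longleftrightarrow>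
     (\<forall>c\<in>A. \<forall>x\<in>coords c.
        almost_contact_metric_vector_space.torsion_components (\<phi> c x) (\<zeta> c x) (\<eta> c x) (g c x)
          (intrinsic_torsion (\<phi> c) (\<zeta> c) (\<eta> c) (g c) x) (\<lambda>i. \<Xi> i c x))"

definition vanishes ::
  "('m, 'e) chart set \<Rightarrow> (('m, 'e) chart \<Rightarrow> 'e \<Rightarrow> 'e \<Rightarrow> 'e \<Rightarrow> 'e::real_vector) \<Rightarrow> bool" where
  "vanishes A S \<longleftrightarrow> (\<forall>c\<in>A. \<forall>x\<in>coords c. \<forall>X Y. S c x X Y = 0)"

definition of_type ::
  "('m, 'e) chart set \<Rightarrow> (nat \<Rightarrow> ('m, 'e) chart \<Rightarrow> 'e \<Rightarrow> 'e \<Rightarrow> 'e \<Rightarrow> 'e::real_vector) \<Rightarrow> nat set \<Rightarrow> bool"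
  where "of_type A \<Xi> I \<longleftrightarrow> (\<forall>i\<in>{1..12} - I. vanishes A (\<Xi> i))"

end

theory Submission
  imports Defs
begin

text \<open>Write \<open>a\<close> and \<open>b\<close> for the factors with \<open>B\<^sub>5 = a \<langle>\<cdot>, \<cdot>\<rangle>\<close> and \<open>B\<^sub>6 = b F\<close> on \<open>H\<close>.  The hypotheses on the type
  exclude all skew parts of \<open>\<nabla>\<eta>\<close> on \<open>H\<close> except that of \<open>B\<^sub>6\<close>, as well as \<open>\<nabla>\<^sub>\<zeta> \<eta>\<close>, so that \<open>d\<eta> = - 2 b F\<close>.
  Applying \<open>d\<close> gives \<open>db \<and> F + b dF = 0\<close> (\<open>d_b_wedge_F\<close>).  The form \<open>dF\<close> is in turn expressed by the
  intrinsic torsion, and the equation is evaluated at points with \<open>b \<noteq> 0\<close>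
  (\<open>nonzero_b_consequences\<close>):

  \<^item> On \<open>H\<close>, \<open>dF\<close> is a cyclic sum of the part of the torsion in \<open>\<C>\<^sub>1 \<oplus> \<C>\<^sub>2 \<oplus> \<C>\<^sub>3\<close>, and contains no multiple
    of \<open>F\<close> by a one-form since the part in \<open>\<C>\<^sub>4\<close> is missing.  For \<open>n > 1\<close> this gives \<open>db = 0\<close> on \<open>H\<close>
    (\<open>cyclic_eq_wedge_F_imp_zero\<close>), then \<open>dF = 0\<close> on \<open>H\<close>, and the components in \<open>\<C>\<^sub>1\<close> and \<open>\<C>\<^sub>3\<close> vanish
    (\<open>cyclic_zero_imp_GH2\<close>).
  \<^item> The part of \<open>dF(\<zeta>, \<cdot>, \<cdot>)\<close> on \<open>H\<close> consists of \<open>- 2 a F\<close>, a trace-free term from \<open>B\<^sub>8\<close> and an anti-invariant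
    term from \<open>\<C>\<^sub>1\<^sub>1\<close>, and has to be a multiple of \<open>F\<close>; so the last two vanish and \<open>db(\<zeta>) = 2 a b\<close>
    (\<open>vertical_equation_imp\<close>).

  Hence \<open>db = 2 a b \<eta>\<close> on the open set where \<open>b \<noteq> 0\<close>.  Applying \<open>d\<close> once more and restricting to \<open>H\<close>, where
  \<open>\<eta> = 0\<close>, gives \<open>0 = 2 a b d\<eta> = - 4 a b\<^sup>2 F\<close>.  Thus \<open>a = 0\<close> and \<open>db = 0\<close> there (\<open>nonzero_b_derivative\<close>), and all
  components except those in \<open>\<C>\<^sub>2 \<oplus> \<C>\<^sub>6 \<oplus> \<C>\<^sub>9\<close> vanish.  As \<open>2 b db = 0\<close> everywhere, \<open>b\<^sup>2\<close> is locally constant;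
  since \<open>M\<close> is connected, \<open>b\<close> vanishes everywhere, and the component in \<open>\<C>\<^sub>6\<close> with it, or nowhere.\<close>

section \<open>Derivatives and symmetry of second derivatives\<close>

lemma frechet_derivative_eqI:
  "(f has_derivative f') (at x) \<Longrightarrow> frechet_derivative f (at x) = f'"
  using frechet_derivative_at by metis

lemma frechet_derivative_cong_open:
  assumes "open S" "x \<in> S" "\<And>y. y \<in> S \<Longrightarrow> f y = g y"
  shows "frechet_derivative f (at x) = frechet_derivative g (at x)"
proof -
  have "(f has_derivative f') (at x) \<longleftrightarrow> (g has_derivative f') (at x)" for f'
    using assms has_derivative_transform_within_open[of f f' x UNIV S g]
      has_derivative_transform_within_open[of g f' x UNIV S f] by auto
  then show ?thesis unfolding frechet_derivative_def by simp
qed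

lemma differentiable_cong_open:
  assumes "open S" "x \<in> S" "\<And>y. y \<in> S \<Longrightarrow> f y = g y" "f differentiable (at x)"
  shows "g differentiable (at x)"
  using assms has_derivative_transform_within_open[of f _ x UNIV S g]
  unfolding differentiable_def by metis

lemma C_k_on_cong:
  assumes "open S" "\<And>y. y \<in> S \<Longrightarrow> f y = g y" "C_k_on k S f"
  shows "C_k_on k S g"
  using assms(2,3)
proof (induction k arbitrary: f g)
  case 0
  then show ?case using continuous_on_cong[of S S f g] by simp
next
  case (Suc k)
  have "C_k_on k S (\<lambda>x. frechet_derivative g (at x) v)" for v
  proof (rule Suc.IH)
    show "C_k_on k S (\<lambda>x. frechet_derivative f (at x) v)" using Suc.prems by simp
    show "frechet_derivative f (at y) v = frechet_derivative g (at y) v" if "y \<in> S" for y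
      using frechet_derivative_cong_open[OF assms(1) that Suc.prems(1)] by simp
  qed
  moreover have "g differentiable (at x)" if "x \<in> S" for x
    using differentiable_cong_open[OF assms(1) that Suc.prems(1)] Suc.prems(2) that by simp
  ultimately show ?case by simp
qed

lemma C_k_on_Suc_imp:
  assumes "C_k_on (Suc k) S f"
  shows "C_k_on k S f"
  using assms
proof (induction k arbitrary: f)
  case 0
  then show ?case
    by (auto intro!: continuous_at_imp_continuous_on differentiable_imp_continuous_within)
next
  case (Suc k)
  then show ?case by (metis C_k_on.simps(2))
qed

lemma C_k_on_subset:
  assumes "C_k_on k S f" "T \<subseteq> S"
  shows "C_k_on k T f"
  using assms(1)
proof (induction k arbitrary: f)
  case 0 then show ?case using assms(2) continuous_on_subset by auto
next
  case (Suc k) then show ?case using assms(2) by auto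
qed

lemma C_k_on_const: "C_k_on k S (\<lambda>x. c)"
  by (induction k arbitrary: c) auto

lemma frechet_derivative_add:
  assumes "f differentiable (at x)" "g differentiable (at x)"
  shows "frechet_derivative (\<lambda>x. f x + g x) (at x) v =
    frechet_derivative f (at x) v + frechet_derivative g (at x) v"
  using assms frechet_derivative_eqI[OF has_derivative_add] unfolding frechet_derivative_works
  by metis

lemma C_k_on_add:
  assumes "open S" "C_k_on k S f" "C_k_on k S g"
  shows "C_k_on k S (\<lambda>x. f x + g x)"
  using assms(2,3)
proof (induction k arbitrary: f g)
  case 0 then show ?case by (simp add: continuous_on_add)
next
  case (Suc k)
  have "C_k_on k S (\<lambda>x. frechet_derivative (\<lambda>x. f x + g x) (at x) v)" for v
    by (rule C_k_on_cong[OF assms(1), where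
        f = "\<lambda>x. frechet_derivative f (at x) v + frechet_derivative g (at x) v"])
      (use Suc in \<open>auto simp: frechet_derivative_add\<close>)
  then show ?case using Suc.prems by auto
qed

lemma C_k_on_sum:
  assumes "open S" "finite I" "\<And>i. i \<in> I \<Longrightarrow> C_k_on k S (f i)"
  shows "C_k_on k S (\<lambda>x. \<Sum>i\<in>I. f i x)"
  using assms(2,3)
  by (induction I) (auto intro!: C_k_on_add C_k_on_const assms(1))

lemma (in bounded_linear) frechet_derivative_compose:
  assumes "h differentiable (at x)"
  shows "frechet_derivative (\<lambda>x. f (h x)) (at x) v = f (frechet_derivative h (at x) v)"
  using assms frechet_derivative_eqI[OF has_derivative] unfolding frechet_derivative_works
  by metis

lemma (in bounded_bilinear) frechet_derivative_prod:
  assumes "f differentiable (at x)" "h differentiable (at x)"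
  shows "frechet_derivative (\<lambda>x. prod (f x) (h x)) (at x) v =
    prod (f x) (frechet_derivative h (at x) v) + prod (frechet_derivative f (at x) v) (h x)"
  using assms frechet_derivative_eqI[OF FDERIV] unfolding frechet_derivative_works
  by metis

lemma (in bounded_bilinear) differentiable_prod:
  assumes "f differentiable (at x)" "h differentiable (at x)"
  shows "(\<lambda>x. prod (f x) (h x)) differentiable (at x)"
  using assms FDERIV unfolding differentiable_def by blast

lemma (in bounded_bilinear) C_k_on_prod:
  assumes "open S" "C_k_on k S f" "C_k_on k S h"
  shows "C_k_on k S (\<lambda>x. prod (f x) (h x))"
  using assms(2,3)
proof (induction k arbitrary: f h)
  case 0 then show ?case by (simp add: continuous_on)
next
  case (Suc k)
  have "C_k_on k S (\<lambda>x. prod (f x) (frechet_derivative h (at x) v) +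
      prod (frechet_derivative f (at x) v) (h x))" for v
    using Suc C_k_on_Suc_imp[OF Suc.prems(1)] C_k_on_Suc_imp[OF Suc.prems(2)]
    by (intro C_k_on_add assms(1)) auto
  then have "C_k_on k S (\<lambda>x. frechet_derivative (\<lambda>x. prod (f x) (h x)) (at x) v)" for v
    by (rule C_k_on_cong[OF assms(1), rotated])
      (use Suc in \<open>auto simp: frechet_derivative_prod\<close>)
  then show ?case using Suc.prems by (auto intro: differentiable_prod)
qed

lemmas C_k_on_mult = bounded_bilinear.C_k_on_prod[OF bounded_bilinear_mult]

lemma C_k_on_bounded_linear:
  assumes "bounded_linear L" "open S" "C_k_on k S f"
  shows "C_k_on k S (\<lambda>x. L (f x))"
  using assms(3)
proof (induction k arbitrary: f)
  case 0 then show ?case using assms(1) by (simp add: bounded_linear.continuous_on)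
next
  case (Suc k)
  have "C_k_on k S (\<lambda>x. frechet_derivative (\<lambda>x. L (f x)) (at x) v)" for v
    by (rule C_k_on_cong[OF assms(2), where f = "\<lambda>x. L (frechet_derivative f (at x) v)"])
      (use Suc assms(1) in \<open>auto simp: bounded_linear.frechet_derivative_compose\<close>)
  moreover have "(\<lambda>x. L (f x)) differentiable (at x)" if "x \<in> S" for x
    using Suc.prems that bounded_linear.has_derivative[OF assms(1)]
    unfolding differentiable_def C_k_on.simps by blast
  ultimately show ?case by simp
qed

lemma frechet_derivative_inverse_real:
  fixes f :: "'a::real_normed_vector \<Rightarrow> real"
  assumes "f differentiable (at x)" "f x \<noteq> 0"
  shows "frechet_derivative (\<lambda>x. inverse (f x)) (at x) v =
    - frechet_derivative f (at x) v * (inverse (f x) * inverse (f x))"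
proof -
  have "((\<lambda>x. inverse (f x)) has_derivative
      (\<lambda>h. - (inverse (f x) * frechet_derivative f (at x) h * inverse (f x)))) (at x)"
    by (rule Deriv.has_derivative_inverse) (use assms frechet_derivative_works in auto)
  then show ?thesis by (simp add: frechet_derivative_eqI)
qed

lemma C_k_on_inverse:
  fixes f :: "'a::real_normed_vector \<Rightarrow> real"
  assumes "open S" "C_k_on k S f" "\<And>x. x \<in> S \<Longrightarrow> f x \<noteq> 0"
  shows "C_k_on k S (\<lambda>x. inverse (f x))"
  using assms(2)
proof (induction k)
  case 0 then show ?case using assms(3) by (auto intro: continuous_on_inverse)
next
  case (Suc k)
  have "C_k_on k S (\<lambda>x. - frechet_derivative f (at x) v * (inverse (f x) * inverse (f x)))" for v
    using Suc C_k_on_Suc_imp[OF Suc.prems]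
    by (intro C_k_on_mult assms(1) C_k_on_bounded_linear[OF bounded_linear_minus]) auto
  then have "C_k_on k S (\<lambda>x. frechet_derivative (\<lambda>x. inverse (f x)) (at x) v)" for v
    by (rule C_k_on_cong[OF assms(1), rotated])
      (use Suc assms(3) in \<open>auto simp: frechet_derivative_inverse_real\<close>)
  then show ?case using Suc.prems assms(3) by (auto intro: differentiable_inverse)
qed

text \<open>The difference of increments of \<open>f\<close> over a small parallelogram is symmetric in its two sides;
  applying the mean value theorem along one side and then along the other expresses it as a second
  derivative at a point of the parallelogram.\<close>

lemma second_difference_mean_value:
  fixes f :: "'a::real_normed_vector \<Rightarrow> real"
  assumes f: "C_k_on 2 (ball x r) f" and h: "0 < h" "h * (norm u + norm v) < r"
  shows "\<exists>p. dist p x \<le> h * (norm u + norm v) \<and>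
    f (x + h *\<^sub>R u + h *\<^sub>R v) - f (x + h *\<^sub>R u) - f (x + h *\<^sub>R v) + f x =
    h * h * frechet_derivative (\<lambda>y. frechet_derivative f (at y) u) (at p) v"
proof -
  define g where "g y = frechet_derivative f (at y) u" for y
  have f1: "f differentiable (at y)" and g1: "g differentiable (at y)" if "y \<in> ball x r" for y
    using f that unfolding g_def[abs_def] by (auto simp: numeral_2_eq_2)
  have near: "norm (s *\<^sub>R u + t *\<^sub>R v) \<le> h * (norm u + norm v)"
    if "0 \<le> s" "s \<le> h" "0 \<le> t" "t \<le> h" for s t
  proof -
    have "norm (s *\<^sub>R u + t *\<^sub>R v) \<le> s * norm u + t * norm v"
      using norm_triangle_ineq[of "s *\<^sub>R u" "t *\<^sub>R v"] that by simp
    also have "\<dots> \<le> h * norm u + h * norm v"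
      using that by (intro add_mono mult_right_mono) auto
    finally show ?thesis by (simp add: algebra_simps)
  qed
  have inball: "x + s *\<^sub>R u + t *\<^sub>R v \<in> ball x r"
    if "0 \<le> s" "s \<le> h" "0 \<le> t" "t \<le> h" for s t
  proof -
    have "norm (s *\<^sub>R u + t *\<^sub>R v) < r" using near[OF that] h(2) by linarith
    then have "dist (x + s *\<^sub>R u + t *\<^sub>R v) x < r" by (simp add: dist_norm add.assoc)
    then show ?thesis by (simp add: dist_commute)
  qed
  have along_u: "((\<lambda>s. f (x + s *\<^sub>R u + t *\<^sub>R v)) has_real_derivative g (x + s *\<^sub>R u + t *\<^sub>R v)) (at s)"
    if "0 \<le> s" "s \<le> h" "0 \<le> t" "t \<le> h" for s t
  proof -
    have "((\<lambda>s. x + s *\<^sub>R u + t *\<^sub>R v) has_derivative (\<lambda>\<sigma>. \<sigma> *\<^sub>R u)) (at s)"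
      by (auto intro!: derivative_eq_intros)
    from diff_chain_at[OF this f1[OF inball[OF that], unfolded frechet_derivative_works]]
    show ?thesis
      using linear_frechet_derivative[OF f1[OF inball[OF that]]]
      by (simp add: has_field_derivative_def o_def g_def linear_cmul mult_commute_abs)
  qed
  have along_v: "((\<lambda>t. g (x + s *\<^sub>R u + t *\<^sub>R v)) has_real_derivative
      frechet_derivative g (at (x + s *\<^sub>R u + t *\<^sub>R v)) v) (at t)"
    if "0 \<le> s" "s \<le> h" "0 \<le> t" "t \<le> h" for s t
  proof -
    have "((\<lambda>t. x + s *\<^sub>R u + t *\<^sub>R v) has_derivative (\<lambda>\<sigma>. \<sigma> *\<^sub>R v)) (at t)"
      by (auto intro!: derivative_eq_intros)
    from diff_chain_at[OF this g1[OF inball[OF that], unfolded frechet_derivative_works]]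
    show ?thesis
      using linear_frechet_derivative[OF g1[OF inball[OF that]]]
      by (simp add: has_field_derivative_def o_def linear_cmul mult_commute_abs)
  qed
  define k where "k s = f (x + s *\<^sub>R u + h *\<^sub>R v) - f (x + s *\<^sub>R u + 0 *\<^sub>R v)" for s
  have "\<exists>s>0. s < h \<and> k h - k 0 =
      (h - 0) * (g (x + s *\<^sub>R u + h *\<^sub>R v) - g (x + s *\<^sub>R u + 0 *\<^sub>R v))"
    unfolding k_def by (intro MVT2 DERIV_diff along_u) (use h in auto)
  then obtain s where s: "0 < s" "s < h" and
    ks: "k h - k 0 = h * (g (x + s *\<^sub>R u + h *\<^sub>R v) - g (x + s *\<^sub>R u + 0 *\<^sub>R v))"
    by auto
  have "\<exists>t>0. t < h \<and> g (x + s *\<^sub>R u + h *\<^sub>R v) - g (x + s *\<^sub>R u + 0 *\<^sub>R v) =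
      (h - 0) * frechet_derivative g (at (x + s *\<^sub>R u + t *\<^sub>R v)) v"
    by (rule MVT2[where f = "\<lambda>t. g (x + s *\<^sub>R u + t *\<^sub>R v)"]) (use h s along_v in auto)
  then obtain t where t: "0 < t" "t < h" and
    gt: "g (x + s *\<^sub>R u + h *\<^sub>R v) - g (x + s *\<^sub>R u + 0 *\<^sub>R v) =
      h * frechet_derivative g (at (x + s *\<^sub>R u + t *\<^sub>R v)) v"
    by auto
  show ?thesis
    by (rule exI[of _ "x + s *\<^sub>R u + t *\<^sub>R v"])
      (use ks gt near[of s t] s t in \<open>simp add: k_def g_def[abs_def] dist_norm add.assoc\<close>)
qed

text \<open>Both second derivatives take equal values at points arbitrarily close to \<open>x\<close>, so by continuity
  they agree at \<open>x\<close>.\<close>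

lemma second_derivative_symmetric_real:
  fixes f :: "'a::real_normed_vector \<Rightarrow> real"
  assumes "open S" "x \<in> S" and f: "C_k_on 2 S f"
  shows "frechet_derivative (\<lambda>y. frechet_derivative f (at y) u) (at x) v =
    frechet_derivative (\<lambda>y. frechet_derivative f (at y) v) (at x) u" (is "?G u v x = ?G v u x")
proof -
  obtain r where r: "0 < r" "ball x r \<subseteq> S" using assms(1,2) open_contains_ball by blast
  have fr: "C_k_on 2 (ball x r) f" using C_k_on_subset[OF f r(2)] .
  have cont: "continuous_on (ball x r) (?G a b)" for a b
    using fr by (simp add: numeral_2_eq_2)
  have "\<bar>?G u v x - ?G v u x\<bar> \<le> e" if "e > 0" for e
  proof -
    have "\<exists>d>0. d \<le> r \<and> (\<forall>y\<in>ball x r. dist y x < d \<longrightarrow> dist (?G a b y) (?G a b x) < e / 2)" for a b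
    proof -
      obtain d where "d > 0" "\<forall>y\<in>ball x r. dist y x < d \<longrightarrow> dist (?G a b y) (?G a b x) < e / 2"
        using cont[of a b] r(1) \<open>e > 0\<close> unfolding continuous_on_iff
        by (metis centre_in_ball half_gt_zero)
      then show ?thesis using r(1) by (intro exI[of _ "min d r"]) auto
    qed
    then have *: "\<exists>d>0. d \<le> r \<and> (\<forall>y. dist y x < d \<longrightarrow> dist (?G a b y) (?G a b x) < e / 2)" for a b
      by (meson dist_commute mem_ball order_less_le_trans dist_commute_lessI)
    obtain d1 d2 where d: "d1 > 0" "d2 > 0" "d1 \<le> r" "d2 \<le> r"
      and d1: "\<And>y. dist y x < d1 \<Longrightarrow> dist (?G u v y) (?G u v x) < e / 2"
      and d2: "\<And>y. dist y x < d2 \<Longrightarrow> dist (?G v u y) (?G v u x) < e / 2"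
      using *[of u v] *[of v u] by blast
    define h where "h = min d1 d2 / (2 * (norm u + norm v + 1))"
    have pos: "norm u + norm v + 1 > 0" by (simp add: add_nonneg_pos)
    have "h > 0" using d pos unfolding h_def by simp
    have "h * (norm u + norm v) < h * (2 * (norm u + norm v + 1))"
      using \<open>h > 0\<close> by (intro mult_strict_left_mono) (auto simp: add_nonneg_pos)
    also have "\<dots> = min d1 d2" using pos unfolding h_def by simp
    finally have small: "h * (norm u + norm v) < min d1 d2" .
    obtain p where p: "dist p x \<le> h * (norm u + norm v)"
      "f (x + h *\<^sub>R u + h *\<^sub>R v) - f (x + h *\<^sub>R u) - f (x + h *\<^sub>R v) + f x = h * h * ?G u v p"
      using second_difference_mean_value[OF fr \<open>h > 0\<close>, of u v] small d by auto
    obtain q where q: "dist q x \<le> h * (norm v + norm u)"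
      "f (x + h *\<^sub>R v + h *\<^sub>R u) - f (x + h *\<^sub>R v) - f (x + h *\<^sub>R u) + f x = h * h * ?G v u q"
      using second_difference_mean_value[OF fr \<open>h > 0\<close>, of v u] small d by (auto simp: add.commute)
    have "h * h * ?G u v p = h * h * ?G v u q"
      using p(2) q(2) by (simp add: algebra_simps)
    then have "?G u v p = ?G v u q" using \<open>h > 0\<close> by simp
    moreover have "dist (?G u v p) (?G u v x) < e / 2" using d1 p(1) small by auto
    moreover have "dist (?G v u q) (?G v u x) < e / 2"
      using d2 q(1) small by (auto simp: add.commute)
    ultimately show ?thesis unfolding dist_real_def by linarith
  qed
  then have "\<bar>?G u v x - ?G v u x\<bar> \<le> 0" by (rule dense_ge)
  then show ?thesis by simp
qed

lemma second_derivative_symmetric: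
  fixes f :: "'a::real_normed_vector \<Rightarrow> 'b::euclidean_space"
  assumes S: "open S" "x \<in> S" and f: "C_k_on 2 S f"
  shows "frechet_derivative (\<lambda>y. frechet_derivative f (at y) u) (at x) v =
    frechet_derivative (\<lambda>y. frechet_derivative f (at y) v) (at x) u"
proof (rule euclidean_eqI)
  fix e :: 'b
  note lin = bounded_linear_inner_left[of e]
  have fe: "C_k_on 2 S (\<lambda>y. f y \<bullet> e)"
    by (rule C_k_on_bounded_linear[OF lin S(1) f])
  have D: "frechet_derivative (\<lambda>y. frechet_derivative f (at y) a) (at x) b \<bullet> e =
      frechet_derivative (\<lambda>y. frechet_derivative (\<lambda>y. f y \<bullet> e) (at y) a) (at x) b" for a b
  proof -
    have "frechet_derivative (\<lambda>y. frechet_derivative (\<lambda>y. f y \<bullet> e) (at y) a) (at x) =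
      frechet_derivative (\<lambda>y. frechet_derivative f (at y) a \<bullet> e) (at x)"
      by (rule frechet_derivative_cong_open[OF S])
        (use f bounded_linear.frechet_derivative_compose[OF lin] in \<open>auto simp: numeral_2_eq_2\<close>)
    then show ?thesis
      using f S(2) bounded_linear.frechet_derivative_compose[OF lin,
          of "\<lambda>y. frechet_derivative f (at y) a" x b]
      by (simp add: numeral_2_eq_2)
  qed
  show "frechet_derivative (\<lambda>y. frechet_derivative f (at y) u) (at x) v \<bullet> e =
    frechet_derivative (\<lambda>y. frechet_derivative f (at y) v) (at x) u \<bullet> e"
    unfolding D by (rule second_derivative_symmetric_real[OF S fe])
qed

text \<open>The product rule for a field of linear maps applied to a vector field.  Only the values \<open>\<alpha> y w\<close> for
  fixed \<open>w\<close> are differentiable by hypothesis; as the argument lives in a finite-dimensional space, an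
  expansion in the standard basis gives the derivative for a varying argument.\<close>

lemma has_derivative_linear_apply:
  fixes \<alpha> :: "'a::real_normed_vector \<Rightarrow> 'b::euclidean_space \<Rightarrow> 'c::real_normed_vector"
  assumes S: "open S" "x \<in> S" and lin: "\<And>y. y \<in> S \<Longrightarrow> linear (\<alpha> y)"
    and \<alpha>: "\<And>w. (\<lambda>y. \<alpha> y w) differentiable (at x)" and W: "W differentiable (at x)"
  shows "((\<lambda>y. \<alpha> y (W y)) has_derivative
    (\<lambda>u. frechet_derivative (\<lambda>y. \<alpha> y (W x)) (at x) u + \<alpha> x (frechet_derivative W (at x) u))) (at x)"
proof -
  have expand: "\<alpha> y w = (\<Sum>i\<in>Basis. (w \<bullet> i) *\<^sub>R \<alpha> y i)" if "y \<in> S" for y w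
  proof -
    have "\<alpha> y w = \<alpha> y (\<Sum>i\<in>Basis. (w \<bullet> i) *\<^sub>R i)" by (simp add: euclidean_representation)
    then show ?thesis using lin[OF that] by (simp add: linear_sum linear_cmul)
  qed
  note Wd = W[unfolded frechet_derivative_works] and \<alpha>d = \<alpha>[unfolded frechet_derivative_works]
  have D: "((\<lambda>y. \<Sum>i\<in>Basis. (W y \<bullet> i) *\<^sub>R \<alpha> y i) has_derivative
     (\<lambda>u. \<Sum>i\<in>Basis. (W x \<bullet> i) *\<^sub>R frechet_derivative (\<lambda>y. \<alpha> y i) (at x) u +
        (frechet_derivative W (at x) u \<bullet> i) *\<^sub>R \<alpha> x i)) (at x)"
    by (intro has_derivative_sum has_derivative_scaleR bounded_linear.has_derivative[OF
          bounded_linear_inner_left] Wd \<alpha>d)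
  have "((\<lambda>y. \<Sum>i\<in>Basis. (W x \<bullet> i) *\<^sub>R \<alpha> y i) has_derivative
     (\<lambda>u. \<Sum>i\<in>Basis. (W x \<bullet> i) *\<^sub>R frechet_derivative (\<lambda>y. \<alpha> y i) (at x) u)) (at x)"
    by (intro has_derivative_sum bounded_linear.has_derivative[OF bounded_linear_scaleR_right] \<alpha>d)
  then have "((\<lambda>y. \<alpha> y (W x)) has_derivative
     (\<lambda>u. \<Sum>i\<in>Basis. (W x \<bullet> i) *\<^sub>R frechet_derivative (\<lambda>y. \<alpha> y i) (at x) u)) (at x)"
    by (rule has_derivative_transform_within_open[OF _ S]) (simp add: expand)
  then have "frechet_derivative (\<lambda>y. \<alpha> y (W x)) (at x) =
     (\<lambda>u. \<Sum>i\<in>Basis. (W x \<bullet> i) *\<^sub>R frechet_derivative (\<lambda>y. \<alpha> y i) (at x) u)"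
    by (rule frechet_derivative_eqI)
  then have "(\<lambda>u. \<Sum>i\<in>Basis. (W x \<bullet> i) *\<^sub>R frechet_derivative (\<lambda>y. \<alpha> y i) (at x) u +
        (frechet_derivative W (at x) u \<bullet> i) *\<^sub>R \<alpha> x i) =
      (\<lambda>u. frechet_derivative (\<lambda>y. \<alpha> y (W x)) (at x) u + \<alpha> x (frechet_derivative W (at x) u))"
    by (simp add: sum.distrib expand[OF S(2), of "frechet_derivative W (at x) _"])
  with D show ?thesis
    by (auto intro: has_derivative_transform_within_open[OF _ S] simp: expand)
qed

lemma C_k_on_linear_apply:
  fixes \<alpha> :: "'a::real_normed_vector \<Rightarrow> 'b::euclidean_space \<Rightarrow> 'c::real_normed_vector"
  assumes S: "open S" and lin: "\<And>y. y \<in> S \<Longrightarrow> linear (\<alpha> y)"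
    and \<alpha>: "\<And>w. C_k_on k S (\<lambda>y. \<alpha> y w)" and W: "C_k_on k S W"
  shows "C_k_on k S (\<lambda>y. \<alpha> y (W y))"
proof (rule C_k_on_cong[OF S])
  show "C_k_on k S (\<lambda>y. \<Sum>i\<in>Basis. (W y \<bullet> i) *\<^sub>R \<alpha> y i)"
    by (intro C_k_on_sum S bounded_bilinear.C_k_on_prod[OF bounded_bilinear_scaleR] \<alpha>
        C_k_on_bounded_linear[OF bounded_linear_inner_left] W) simp
  fix y assume "y \<in> S"
  have "\<alpha> y (W y) = \<alpha> y (\<Sum>i\<in>Basis. (W y \<bullet> i) *\<^sub>R i)" by (simp add: euclidean_representation)
  then show "(\<Sum>i\<in>Basis. (W y \<bullet> i) *\<^sub>R \<alpha> y i) = \<alpha> y (W y)"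
    using lin[OF \<open>y \<in> S\<close>] by (simp add: linear_sum linear_cmul)
qed


section \<open>Linear algebra of an almost contact metric vector space\<close>

context almost_contact_metric_vector_space
begin

lemmas g_simps = bilinear_ladd[OF bilinear_g] bilinear_radd[OF bilinear_g]
  bilinear_lmul[OF bilinear_g] bilinear_rmul[OF bilinear_g] bilinear_lneg[OF bilinear_g]
  bilinear_rneg[OF bilinear_g] bilinear_lsub[OF bilinear_g] bilinear_rsub[OF bilinear_g]
  bilinear_lzero[OF bilinear_g] bilinear_rzero[OF bilinear_g]

lemmas \<phi>_simps = linear_add[OF linear_\<phi>] linear_cmul[OF linear_\<phi>] linear_neg[OF linear_\<phi>]
  linear_diff[OF linear_\<phi>] linear_0[OF linear_\<phi>]

lemmas \<eta>_simps = linear_add[OF linear_\<eta>] linear_cmul[OF linear_\<eta>] linear_neg[OF linear_\<eta>]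
  linear_diff[OF linear_\<eta>] linear_0[OF linear_\<eta>]

lemma g_sum_left: "g (\<Sum>i\<in>I. u i *\<^sub>R v i) Y = (\<Sum>i\<in>I. u i * g (v i) Y)"
proof -
  have "linear (\<lambda>X. g X Y)" using bilinear_g by (simp add: bilinear_def)
  from linear_sum[OF this, of "\<lambda>i. u i *\<^sub>R v i" I] show ?thesis by (simp add: g_simps)
qed

lemma \<zeta>_nonzero: "\<zeta> \<noteq> 0"
  using \<eta>_\<zeta> linear_0[OF linear_\<eta>] by auto

lemma \<phi>_\<zeta>: "\<phi> \<zeta> = 0"
proof -
  have "\<phi> (\<phi> \<zeta>) = 0" by (simp add: \<phi>_\<phi> \<eta>_\<zeta>)
  then have c: "\<phi> \<zeta> = \<eta> (\<phi> \<zeta>) *\<^sub>R \<zeta>" using \<phi>_\<phi>[of "\<phi> \<zeta>"] by (simp add: \<phi>_simps)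
  then have "\<phi> (\<phi> \<zeta>) = \<eta> (\<phi> \<zeta>) *\<^sub>R \<phi> \<zeta>" by (metis linear_cmul linear_\<phi>)
  then show ?thesis using \<open>\<phi> (\<phi> \<zeta>) = 0\<close> c by auto
qed

lemma \<eta>_\<phi>: "\<eta> (\<phi> X) = 0"
proof -
  have "\<phi> (\<phi> (\<phi> X)) = - \<phi> X"
    by (subst \<phi>_\<phi>[of X]) (simp add: \<phi>_simps \<phi>_\<zeta>)
  then show ?thesis using \<phi>_\<phi>[of "\<phi> X"] \<zeta>_nonzero by (simp add: \<eta>_simps)
qed

lemma g_\<zeta>: "g \<zeta> X = \<eta> X"
  using g_\<phi>_\<phi>[of \<zeta> X] by (simp add: \<phi>_\<zeta> g_simps \<eta>_\<zeta>)

lemma g_\<zeta>_right: "g X \<zeta> = \<eta> X"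
  using g_\<zeta> g_symmetric by metis

lemma g_\<phi>_left: "g (\<phi> X) Y = - g X (\<phi> Y)"
  using g_\<phi>_\<phi>[of X "\<phi> Y"] by (simp add: \<phi>_\<phi> g_simps g_\<zeta>_right \<eta>_\<phi>)

lemma F_skew: "F X Y = - F Y X"
  unfolding F_def using g_\<phi>_left g_symmetric by metis

lemma H_iff: "X \<in> H \<longleftrightarrow> \<eta> X = 0"
  by (simp add: H_def g_\<zeta>)

lemma \<phi>_in_H [simp]: "\<phi> X \<in> H"
  by (simp add: H_iff \<eta>_\<phi>)

lemma hor_in_H [simp]: "hor X \<in> H"
  by (simp add: H_iff hor_def \<eta>_simps \<eta>_\<zeta>)

lemma hor_H: "X \<in> H \<Longrightarrow> hor X = X"
  by (simp add: H_iff hor_def)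

lemma \<phi>_\<phi>_H: "X \<in> H \<Longrightarrow> \<phi> (\<phi> X) = - X"
  by (simp add: \<phi>_\<phi> H_iff)

lemma g_\<phi>_\<phi>_H: "X \<in> H \<Longrightarrow> g (\<phi> X) (\<phi> Y) = g X Y"
  by (simp add: g_\<phi>_\<phi> H_iff)

lemma g_hor_left: "Z \<in> H \<Longrightarrow> g (hor X) Z = g X Z"
  by (simp add: hor_def g_simps g_\<zeta> H_iff)

lemma g_eq_zero_iff: "g X X = 0 \<longleftrightarrow> X = 0"
  using g_positive[of X] by (cases "X = 0") (auto simp: g_simps)

lemma g_nondegenerate: "(\<And>Z. g X Z = 0) \<Longrightarrow> X = 0"
  using g_eq_zero_iff by blast

lemma g_nondegenerate_H: "X \<in> H \<Longrightarrow> (\<And>Z. Z \<in> H \<Longrightarrow> g X Z = 0) \<Longrightarrow> X = 0"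
  using g_eq_zero_iff by blast

lemma orthonormal_expansion:
  assumes "finite E" "\<forall>e\<in>E. \<forall>f\<in>E. g e f = (if e = f then 1 else 0)" "X \<in> span E"
  shows "X = (\<Sum>e\<in>E. g X e *\<^sub>R e)"
proof -
  obtain u where X: "X = (\<Sum>e\<in>E. u e *\<^sub>R e)" using assms(1,3) by (auto simp: span_finite)
  have "g X e = u e" if "e \<in> E" for e
  proof -
    have "g X e = (\<Sum>f\<in>E. u f * g f e)"
      unfolding X by (rule g_sum_left)
    also have "\<dots> = (\<Sum>f\<in>E. if f = e then u f else 0)"
      using assms(2) that by (intro sum.cong) auto
    finally show ?thesis using that assms(1) by simp
  qed
  then show ?thesis using X by simp
qed

lemma orthonormal_independent:
  assumes "finite E" "\<forall>e\<in>E. \<forall>f\<in>E. g e f = (if e = f then 1 else 0)"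
  shows "independent E"
proof (rule independent_if_scalars_zero[OF assms(1)])
  fix u e assume 0: "(\<Sum>x\<in>E. u x *\<^sub>R x) = 0" and e: "e \<in> E"
  have "g (\<Sum>x\<in>E. u x *\<^sub>R x) e = (\<Sum>f\<in>E. u f * g f e)"
    by (rule g_sum_left)
  also have "\<dots> = (\<Sum>f\<in>E. if f = e then u f else 0)"
    using assms(2) e by (intro sum.cong) auto
  finally show "u e = 0" using 0 e assms(1) by (simp add: g_simps)
qed

text \<open>A \<open>g\<close>-orthonormal subset of \<open>H\<close> of maximal cardinality spans \<open>H\<close>: otherwise the component of some
  vector orthogonal to the set could be normalised and added to it.\<close>

lemma ex_orthonormal_basis_H:
  obtains E where "orthonormal_basis_H E" and "card E + 1 = DIM('e)"
proof -
  define P where "P E \<longleftrightarrow> finite E \<and> E \<subseteq> H \<and> (\<forall>e\<in>E. \<forall>f\<in>E. g e f = (if e = f then 1 else 0))"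
    for E :: "'e set"
  have bound: "card E \<le> DIM('e)" if "P E" for E
    using that orthonormal_independent independent_bound unfolding P_def by auto
  have "P {}" by (simp add: P_def)
  then obtain E where E: "P E" and max: "\<And>E'. P E' \<Longrightarrow> card E' \<le> card E"
    using ex_has_greatest_nat[of P "{}" card "DIM('e) + 1"] bound by (metis Suc_eq_plus1 le_imp_less_Suc)
  have span: "X \<in> span E" if "X \<in> H" for X
  proof (rule ccontr)
    assume notin: "X \<notin> span E"
    define R where "R = X - (\<Sum>e\<in>E. g X e *\<^sub>R e)"
    have sum_in: "(\<Sum>e\<in>E. g X e *\<^sub>R e) \<in> span E"
      by (intro span_sum span_scale span_base)
    then have "R \<noteq> 0" using notin unfolding R_def by auto
    have "subspace H" unfolding subspace_def by (auto simp: H_iff \<eta>_simps)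
    then have "R \<in> H" using that E unfolding R_def P_def
      by (intro subspace_diff subspace_sum subspace_scale) auto
    have orth: "g R e = 0" if "e \<in> E" for e
    proof -
      have "g (\<Sum>f\<in>E. g X f *\<^sub>R f) e = (\<Sum>f\<in>E. g X f * g f e)"
        by (rule g_sum_left)
      also have "\<dots> = (\<Sum>f\<in>E. if f = e then g X f else 0)"
        using E that unfolding P_def by (intro sum.cong) auto
      finally have "g (\<Sum>f\<in>E. g X f *\<^sub>R f) e = g X e" using that E unfolding P_def by simp
      then show ?thesis unfolding R_def by (simp add: g_simps)
    qed
    define r where "r = (1 / sqrt (g R R)) *\<^sub>R R"
    have "g R R > 0" using g_positive \<open>R \<noteq> 0\<close> by simp
    then have "g r r = 1" unfolding r_def by (simp add: g_simps)
    have "r \<in> H" using \<open>R \<in> H\<close> by (simp add: r_def H_iff \<eta>_simps)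
    have rE: "g r e = 0" "g e r = 0" if "e \<in> E" for e
      using orth[OF that] g_symmetric[of e R] by (auto simp: r_def g_simps)
    have "r \<notin> E" using rE \<open>g r r = 1\<close> by auto
    have "P (insert r E)"
      using E rE \<open>g r r = 1\<close> \<open>r \<in> H\<close> \<open>r \<notin> E\<close> unfolding P_def by auto
    then show False using max[of "insert r E"] \<open>r \<notin> E\<close> E unfolding P_def by simp
  qed
  then have basis: "orthonormal_basis_H E"
    using E unfolding P_def orthonormal_basis_H_def by auto
  have "\<zeta> \<notin> E" using E \<eta>_\<zeta> unfolding P_def by (auto simp: H_iff)
  have indep: "independent (insert \<zeta> E)"
  proof (rule orthonormal_independent)
    show "\<forall>e\<in>insert \<zeta> E. \<forall>f\<in>insert \<zeta> E. g e f = (if e = f then 1 else 0)"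
      using E \<open>\<zeta> \<notin> E\<close> \<eta>_\<zeta> unfolding P_def by (auto simp: g_\<zeta> g_\<zeta>_right H_iff subset_iff)
  qed (use E P_def in auto)
  have "X \<in> span (insert \<zeta> E)" for X
  proof -
    have "X = hor X + \<eta> X *\<^sub>R \<zeta>" by (simp add: hor_def)
    moreover have "hor X \<in> span (insert \<zeta> E)"
      using span[of "hor X"] span_mono[of E "insert \<zeta> E"] by auto
    ultimately show ?thesis by (metis insertI1 span_add span_base span_scale)
  qed
  then have "DIM('e) = card (insert \<zeta> E)"
    using indep by (metis UNIV_eq_I basis_card_eq_dim dim_UNIV subset_UNIV)
  then show ?thesis using that[OF basis] \<open>\<zeta> \<notin> E\<close> E unfolding P_def by simp
qed

lemma linear_expansion_H:
  assumes "orthonormal_basis_H E" "linear f" "X \<in> H"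
  shows "f X = (\<Sum>e\<in>E. g X e * (f e :: real))"
proof -
  have "X = (\<Sum>e\<in>E. g X e *\<^sub>R e)"
    using assms(1,3) orthonormal_expansion unfolding orthonormal_basis_H_def by blast
  then have "f X = f (\<Sum>e\<in>E. g X e *\<^sub>R e)" by simp
  then show ?thesis using assms(2) by (simp add: linear_sum linear_cmul)
qed

lemma F_nonzero:
  assumes "DIM('e) > 1"
  obtains X Y where "X \<in> H" "Y \<in> H" "F X Y \<noteq> 0"
proof -
  obtain E where E: "orthonormal_basis_H E" "card E + 1 = DIM('e)" using ex_orthonormal_basis_H .
  then obtain e where "e \<in> E" using assms by (metis add_0 card.empty equals0I less_irrefl)
  then have "e \<in> H" "g e e = 1" using E(1) unfolding orthonormal_basis_H_def by auto
  then have "F e (\<phi> e) \<noteq> 0" by (simp add: F_def \<phi>_\<phi>_H g_simps)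
  with \<open>e \<in> H\<close> show ?thesis by (rule that[OF _ \<phi>_in_H])
qed


section \<open>The exterior derivative of the fundamental form, algebraically\<close>

lemma GH_space_\<phi>_shift:
  assumes "S \<in> GH_space" "X \<in> H" "Y \<in> H" "Z \<in> H"
  shows "g (S X Y) (\<phi> Z) = g (S X (\<phi> Y)) Z"
proof -
  have "g (S X (\<phi> Y)) (\<phi> (\<phi> Z)) = - g (S X Y) (\<phi> Z)"
    using assms \<phi>_in_H[of Z] unfolding GH_space_def by blast
  then show ?thesis using assms(4) by (simp add: \<phi>_\<phi>_H g_simps)
qed

lemma GH_space_skew:
  "S \<in> GH_space \<Longrightarrow> X \<in> H \<Longrightarrow> Y \<in> H \<Longrightarrow> Z \<in> H \<Longrightarrow> g (S X Y) Z = - g (S X Z) Y"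
  unfolding GH_space_def by blast

lemma GH_space_zeroI:
  assumes "S \<in> GH_space" "\<And>X Y Z. X \<in> H \<Longrightarrow> Y \<in> H \<Longrightarrow> Z \<in> H \<Longrightarrow> g (S X Y) Z = 0"
  shows "S X Y = 0"
proof -
  have "hor (S (hor X) (hor Y)) = 0"
    using assms(2) by (intro g_nondegenerate_H) (auto simp: g_hor_left)
  moreover have "S X Y = hor (S (hor X) (hor Y))" using assms(1) unfolding GH_space_def by blast
  ultimately show ?thesis by simp
qed

text \<open>The cyclic sum of \<open>\<langle>S\<^sub>X Y, \<phi> Z\<rangle>\<close> is half of the horizontal part of \<open>dF\<close> when \<open>S\<close> is that of the
  intrinsic torsion.  Its contraction with \<open>F\<close> vanishes for \<open>S \<in> \<C>\<^sub>1 \<oplus> \<C>\<^sub>2 \<oplus> \<C>\<^sub>3\<close>, whereas the contraction of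
  \<open>\<theta> \<and> F\<close> is \<open>(2 - 2n) \<theta>\<close>, where \<open>2n = dim H\<close>.  This is where dimension three has to be excluded.\<close>

lemma cyclic_eq_wedge_F_imp_zero:
  assumes S1: "S1 \<in> GH1_class" and S2: "S2 \<in> GH2_class" and S3: "S3 \<in> GH3_class"
    and S: "\<And>X Y. S X Y = S1 X Y + S2 X Y + S3 X Y"
    and \<theta>: "linear \<theta>" and dim: "DIM('e) > 3"
    and eq: "\<And>X Y Z. X \<in> H \<Longrightarrow> Y \<in> H \<Longrightarrow> Z \<in> H \<Longrightarrow>
      g (S X Y) (\<phi> Z) + g (S Y Z) (\<phi> X) + g (S Z X) (\<phi> Y) =
      \<theta> X * F Y Z + \<theta> Y * F Z X + \<theta> Z * F X Y"
    and X: "X \<in> H"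
  shows "\<theta> X = 0"
proof -
  obtain E where E: "orthonormal_basis_H E" "card E + 1 = DIM('e)" using ex_orthonormal_basis_H .
  have EH: "e \<in> H" and E1: "g e e = 1" if "e \<in> E" for e
    using E(1) that unfolding orthonormal_basis_H_def by auto
  have GH: "S1 \<in> GH_space" "S2 \<in> GH_space" "S3 \<in> GH_space"
    using S1 S2 S3 unfolding GH1_class_def GH2_class_def GH3_class_def by auto
  \<comment> \<open>The equation at \<open>(X, e, \<phi> e)\<close>, to be summed over an orthonormal basis.\<close>
  have summand: "- 2 * g (S3 e e) X = - \<theta> X + g X e * \<theta> e - g (\<phi> X) e * \<theta> (\<phi> e)" if "e \<in> E" for e
  proof -
    note e = EH[OF that]
    have space: "g (T X e) (\<phi> (\<phi> e)) = 0 \<and> g (T e (\<phi> e)) (\<phi> X) = - g (T e e) X \<and>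
      g (T (\<phi> e) X) (\<phi> e) = - g (T (\<phi> e) (\<phi> e)) X" if T: "T \<in> GH_space" for T
    proof (intro conjI)
      show "g (T X e) (\<phi> (\<phi> e)) = 0"
        using GH_space_skew[OF T X e e] e by (simp add: \<phi>_\<phi>_H g_simps)
      show "g (T e (\<phi> e)) (\<phi> X) = - g (T e e) X"
        using T e X unfolding GH_space_def by blast
      show "g (T (\<phi> e) X) (\<phi> e) = - g (T (\<phi> e) (\<phi> e)) X"
        by (rule GH_space_skew[OF T]) (use X in auto)
    qed
    have "g (S1 u u) X = 0" if "u \<in> H" for u
    proof -
      have "g (S1 u u) X = - g (S1 u u) X" using S1 that X unfolding GH1_class_def by blast
      then show ?thesis by simp
    qed
    then have c1: "g (S1 e e) X = 0" "g (S1 (\<phi> e) (\<phi> e)) X = 0" using e by auto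
    have c2: "g (S2 (\<phi> e) (\<phi> e)) X = - g (S2 e e) X"
      using S2 e X unfolding GH2_class_def by blast
    have c3: "g (S3 (\<phi> e) (\<phi> e)) X = g (S3 e e) X"
      using S3 e X unfolding GH3_class_def by blast
    have "g (S X e) (\<phi> (\<phi> e)) + g (S e (\<phi> e)) (\<phi> X) + g (S (\<phi> e) X) (\<phi> e) = - 2 * g (S3 e e) X"
      using space[OF GH(1)] space[OF GH(2)] space[OF GH(3)] c1 c2 c3 by (simp add: S g_simps)
    moreover have "F e (\<phi> e) = -1" "F (\<phi> e) X = g X e" "F X e = - g (\<phi> X) e"
      using e E1[OF that] X g_symmetric[of X e] g_\<phi>_left[of X e]
      by (auto simp: F_def \<phi>_\<phi>_H g_simps g_\<phi>_\<phi>_H)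
    ultimately show ?thesis
      using eq[OF X e, of "\<phi> e"] by (simp add: algebra_simps)
  qed
  have "(\<Sum>e\<in>E. - 2 * g (S3 e e) X) = (\<Sum>e\<in>E. - \<theta> X + g X e * \<theta> e - g (\<phi> X) e * \<theta> (\<phi> e))"
    by (rule sum.cong) (use summand in auto)
  moreover have "(\<Sum>e\<in>E. - 2 * g (S3 e e) X) = 0"
    using S3 E(1) X unfolding GH3_class_def sum_distrib_left[symmetric] by simp
  moreover have "(\<Sum>e\<in>E. g X e * \<theta> e) = \<theta> X"
    using linear_expansion_H[OF E(1) \<theta> X] by simp
  moreover have "(\<Sum>e\<in>E. g (\<phi> X) e * \<theta> (\<phi> e)) = - \<theta> X"
    using linear_expansion_H[OF E(1) linear_compose[OF linear_\<phi> \<theta>], of "\<phi> X"] X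
    by (simp add: \<phi>_\<phi>_H linear_neg[OF \<theta>])
  ultimately have "0 = - (of_nat (card E) * \<theta> X) + \<theta> X + \<theta> X"
    by (simp add: sum.distrib sum_subtractf)
  then have "(real (card E) - 2) * \<theta> X = 0" by (simp add: algebra_simps)
  then show ?thesis using E(2) dim by auto
qed

text \<open>The cyclic sum vanishes for \<open>S \<in> \<C>\<^sub>2\<close>, is of type \<open>(3,0) + (0,3)\<close> for \<open>S \<in> \<C>\<^sub>1\<close> and of type
  \<open>(2,1) + (1,2)\<close> for \<open>S \<in> \<C>\<^sub>3\<close>, and determines \<open>S\<close> in the latter two cases.  Applying \<open>\<phi>\<close> to two of the three
  arguments, in all three ways, and adding the results multiplies forms of the first type by \<open>-3\<close> and
  forms of the second type by \<open>1\<close>, so that both parts have to vanish separately.\<close>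

lemma cyclic_zero_imp_GH2:
  assumes S1: "S1 \<in> GH1_class" and S2: "S2 \<in> GH2_class" and S3: "S3 \<in> GH3_class"
    and S: "\<And>X Y. S X Y = S1 X Y + S2 X Y + S3 X Y"
    and eq: "\<And>X Y Z. X \<in> H \<Longrightarrow> Y \<in> H \<Longrightarrow> Z \<in> H \<Longrightarrow>
      g (S X Y) (\<phi> Z) + g (S Y Z) (\<phi> X) + g (S Z X) (\<phi> Y) = 0"
  shows "S1 X Y = 0" and "S3 X Y = 0"
proof -
  have GH: "S1 \<in> GH_space" "S2 \<in> GH_space" "S3 \<in> GH_space"
    using S1 S2 S3 unfolding GH1_class_def GH2_class_def GH3_class_def by auto
  define T1 where "T1 X Y Z = g (S1 X Y) Z" for X Y Z
  define T3 where "T3 X Y Z = g (S3 X Y) Z" for X Y Z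
  have bil: "bilinear S1" "bilinear S3" using GH unfolding GH_space_def by auto
  have neg1: "T1 (- X) Y Z = - T1 X Y Z" "T1 X (- Y) Z = - T1 X Y Z" "T1 X Y (- Z) = - T1 X Y Z" for X Y Z
    by (auto simp: T1_def bilinear_lneg[OF bil(1)] bilinear_rneg[OF bil(1)] g_simps)
  have neg3: "T3 (- X) Y Z = - T3 X Y Z" "T3 X (- Y) Z = - T3 X Y Z" "T3 X Y (- Z) = - T3 X Y Z" for X Y Z
    by (auto simp: T3_def bilinear_lneg[OF bil(2)] bilinear_rneg[OF bil(2)] g_simps)
  have skew1: "T1 X Y Z = - T1 Y X Z" "T1 X Y Z = - T1 X Z Y" if "X \<in> H" "Y \<in> H" "Z \<in> H" for X Y Z
    using S1 that unfolding GH1_class_def T1_def by blast+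
  have shift1: "T1 X (\<phi> Y) Z = T1 X Y (\<phi> Z)" if "X \<in> H" "Y \<in> H" "Z \<in> H" for X Y Z
    using GH_space_\<phi>_shift[OF GH(1) that] by (simp add: T1_def)
  have shift1': "T1 (\<phi> X) Y Z = T1 X Y (\<phi> Z)" if "X \<in> H" "Y \<in> H" "Z \<in> H" for X Y Z
  proof -
    have "T1 (\<phi> X) Y Z = - T1 Y (\<phi> X) Z" by (rule skew1) (use that in auto)
    also have "\<dots> = - T1 Y X (\<phi> Z)" using shift1 that by simp
    also have "\<dots> = T1 X Y (\<phi> Z)" using skew1(1)[of X Y "\<phi> Z"] that by simp
    finally show ?thesis .
  qed
  have shift3: "T3 X (\<phi> Y) Z = T3 X Y (\<phi> Z)" if "X \<in> H" "Y \<in> H" "Z \<in> H" for X Y Z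
    using GH_space_\<phi>_shift[OF GH(3) that] by (simp add: T3_def)
  have shift3': "T3 (\<phi> X) Y Z = - T3 X Y (\<phi> Z)" if "X \<in> H" "Y \<in> H" "Z \<in> H" for X Y Z
  proof -
    have "T3 (\<phi> X) (\<phi> (\<phi> Y)) Z = T3 X (\<phi> Y) Z"
      using S3 that \<phi>_in_H unfolding GH3_class_def T3_def by blast
    then show ?thesis using shift3 that by (simp add: \<phi>_\<phi>_H neg3)
  qed
  have cyc1: "T1 Y Z (\<phi> X) = T1 X Y (\<phi> Z)" if "X \<in> H" "Y \<in> H" "Z \<in> H" for X Y Z
  proof -
    have "T1 Y Z (\<phi> X) = - T1 Y (\<phi> X) Z" by (rule skew1) (use that in auto)
    also have "\<dots> = T1 (\<phi> X) Y Z" using skew1(1)[of "\<phi> X" Y Z] that by simp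
    finally show ?thesis using shift1' that by simp
  qed
  have cyc2: "g (S2 X Y) (\<phi> Z) + g (S2 Y Z) (\<phi> X) + g (S2 Z X) (\<phi> Y) = 0"
    if "X \<in> H" "Y \<in> H" "Z \<in> H" for X Y Z
  proof -
    have bil2: "bilinear S2" using GH unfolding GH_space_def by auto
    have "g (S2 (\<phi> Z) (\<phi> (\<phi> X))) Y = - g (S2 Z (\<phi> X)) Y"
      using S2 that \<phi>_in_H unfolding GH2_class_def by blast
    then have "g (S2 (\<phi> Z) X) Y = g (S2 Z X) (\<phi> Y)"
      using that GH_space_\<phi>_shift[OF GH(2), of Z X Y]
      by (simp add: \<phi>_\<phi>_H bilinear_rneg[OF bil2] g_simps)
    moreover have "g (S2 Y (\<phi> Z)) X = g (S2 Y Z) (\<phi> X)"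
      using that GH_space_\<phi>_shift[OF GH(2), of Y Z X] by simp
    moreover have "g (S2 X Y) (\<phi> Z) + g (S2 Y (\<phi> Z)) X + g (S2 (\<phi> Z) X) Y = 0"
      using S2 that \<phi>_in_H unfolding GH2_class_def by blast
    ultimately show ?thesis by simp
  qed
  have eq': "3 * T1 X Y (\<phi> Z) + (T3 X Y (\<phi> Z) + T3 Y Z (\<phi> X) + T3 Z X (\<phi> Y)) = 0"
    if "X \<in> H" "Y \<in> H" "Z \<in> H" for X Y Z
  proof -
    have "T1 X Y (\<phi> Z) + T1 Y Z (\<phi> X) + T1 Z X (\<phi> Y) +
        (T3 X Y (\<phi> Z) + T3 Y Z (\<phi> X) + T3 Z X (\<phi> Y)) = 0"
      using eq[OF that] cyc2[OF that] by (simp add: S g_simps T1_def T3_def)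
    moreover have "T1 Y Z (\<phi> X) = T1 X Y (\<phi> Z)" "T1 Z X (\<phi> Y) = T1 X Y (\<phi> Z)"
      using cyc1[OF that] cyc1[of Y Z X] that by auto
    ultimately show ?thesis by simp
  qed
  note rules = shift1 shift1' shift3 shift3' neg1 neg3 \<phi>_\<phi>_H
  have zero: "T1 X Y (\<phi> Z) = 0" "T3 Z X (\<phi> Y) = 0" if XYZ: "X \<in> H" "Y \<in> H" "Z \<in> H" for X Y Z
  proof -
    have r1: "T1 (\<phi> X) (\<phi> Y) (\<phi> Z) = - T1 X Y (\<phi> Z)" "T1 X (\<phi> Y) (\<phi> (\<phi> Z)) = - T1 X Y (\<phi> Z)"
      "T1 (\<phi> X) Y (\<phi> (\<phi> Z)) = - T1 X Y (\<phi> Z)"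
      using XYZ by (simp_all add: rules)
    have r2: "T3 (\<phi> X) (\<phi> Y) (\<phi> Z) = T3 X Y (\<phi> Z)" "T3 X (\<phi> Y) (\<phi> (\<phi> Z)) = - T3 X Y (\<phi> Z)"
      "T3 (\<phi> X) Y (\<phi> (\<phi> Z)) = T3 X Y (\<phi> Z)"
      using XYZ by (simp_all add: rules)
    have r3: "T3 (\<phi> Y) Z (\<phi> (\<phi> X)) = T3 Y Z (\<phi> X)" "T3 (\<phi> Y) (\<phi> Z) (\<phi> X) = T3 Y Z (\<phi> X)"
      "T3 Y (\<phi> Z) (\<phi> (\<phi> X)) = - T3 Y Z (\<phi> X)"
      using XYZ by (simp_all add: rules)
    have r4: "T3 Z (\<phi> X) (\<phi> (\<phi> Y)) = - T3 Z X (\<phi> Y)" "T3 (\<phi> Z) X (\<phi> (\<phi> Y)) = T3 Z X (\<phi> Y)"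
      "T3 (\<phi> Z) (\<phi> X) (\<phi> Y) = T3 Z X (\<phi> Y)"
      using XYZ by (simp_all add: rules)
    note r = r1 r2 r3 r4
    have "3 * - T1 X Y (\<phi> Z) + (T3 X Y (\<phi> Z) + T3 Y Z (\<phi> X) + - T3 Z X (\<phi> Y)) = 0"
      using eq'[OF \<phi>_in_H[of X] \<phi>_in_H[of Y] XYZ(3)] by (simp only: r)
    moreover have "3 * - T1 X Y (\<phi> Z) + (- T3 X Y (\<phi> Z) + T3 Y Z (\<phi> X) + T3 Z X (\<phi> Y)) = 0"
      using eq'[OF XYZ(1) \<phi>_in_H[of Y] \<phi>_in_H[of Z]] by (simp only: r)
    moreover have "3 * - T1 X Y (\<phi> Z) + (T3 X Y (\<phi> Z) + - T3 Y Z (\<phi> X) + T3 Z X (\<phi> Y)) = 0"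
      using eq'[OF \<phi>_in_H[of X] XYZ(2) \<phi>_in_H[of Z]] by (simp only: r)
    ultimately show "T1 X Y (\<phi> Z) = 0" "T3 Z X (\<phi> Y) = 0"
      using eq'[OF XYZ] by linarith+
  qed
  show "S1 X Y = 0"
  proof (rule GH_space_zeroI[OF GH(1)])
    fix X Y Z assume "X \<in> H" "Y \<in> H" "Z \<in> H"
    then show "g (S1 X Y) Z = 0"
      using zero(1)[of X Y "\<phi> Z"] by (simp add: \<phi>_\<phi>_H T1_def g_simps)
  qed
  show "S3 X Y = 0"
  proof (rule GH_space_zeroI[OF GH(3)])
    fix X Y Z assume "X \<in> H" "Y \<in> H" "Z \<in> H"
    then show "g (S3 X Y) Z = 0"
      using zero(2)[of Y "\<phi> Z" X] by (simp add: \<phi>_\<phi>_H T3_def g_simps)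
  qed
qed


text \<open>Extracts from the definition of the components the form \<open>\<xi> \<eta>\<close> on \<open>H\<close>, with its four remaining parts,
  and how the vanishing of a part is reflected in \<open>\<Xi>\<close>.\<close>

lemma torsion_components_mixed:
  assumes tc: "torsion_components \<xi> \<Xi>" and "\<And>X Y. \<Xi> 7 X Y = 0" "\<And>X Y. \<Xi> 10 X Y = 0"
  obtains a b B8 B9 where "B8 \<in> B8_class" "B9 \<in> B9_class"
    and "\<And>X Y. X \<in> H \<Longrightarrow> Y \<in> H \<Longrightarrow> - \<eta> (\<xi> X Y) = a * g X Y + b * F X Y + B8 X Y + B9 X Y"
    and "a = 0 \<Longrightarrow> \<forall>X Y. \<Xi> 5 X Y = 0" and "b = 0 \<Longrightarrow> \<forall>X Y. \<Xi> 6 X Y = 0"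
    and "\<forall>X\<in>H. \<forall>Y\<in>H. B8 X Y = 0 \<Longrightarrow> \<forall>X Y. \<Xi> 8 X Y = 0"
proof -
  have "\<exists>B. B 5 \<in> B5_class \<and> B 6 \<in> B6_class \<and> B 7 \<in> B7_class \<and>
          B 8 \<in> B8_class \<and> B 9 \<in> B9_class \<and> B 10 \<in> B10_class \<and>
          (\<forall>X Y. - \<eta> (\<xi> (hor X) (hor Y)) = (\<Sum>i=5..10. B i (hor X) (hor Y))) \<and>
          (\<forall>i\<in>{5..10}. \<forall>X Y Z. g (\<Xi> i X Y) Z =
             \<eta> Y * B i (hor X) (hor Z) - \<eta> Z * B i (hor X) (hor Y))"
    using tc unfolding torsion_components_def by (elim conjE)
  then obtain B where B: "B 5 \<in> B5_class" "B 6 \<in> B6_class" "B 8 \<in> B8_class" "B 9 \<in> B9_class"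
    and sum: "\<forall>X Y. - \<eta> (\<xi> (hor X) (hor Y)) = (\<Sum>i=5..10. B i (hor X) (hor Y))"
    and \<Xi>': "\<forall>i\<in>{5..10}. \<forall>X Y Z. g (\<Xi> i X Y) Z =
             \<eta> Y * B i (hor X) (hor Z) - \<eta> Z * B i (hor X) (hor Y)"
    by (elim exE conjE) (rule that)
  have \<Xi>: "g (\<Xi> i X Y) Z = \<eta> Y * B i (hor X) (hor Z) - \<eta> Z * B i (hor X) (hor Y)"
    if "i \<in> {5..10}" for i X Y Z
    using \<Xi>' that by blast
  obtain a where a: "\<And>X Y. X \<in> H \<Longrightarrow> Y \<in> H \<Longrightarrow> B 5 X Y = a * g X Y"
    using B(1) unfolding B5_class_def by blast
  obtain b where b: "\<And>X Y. X \<in> H \<Longrightarrow> Y \<in> H \<Longrightarrow> B 6 X Y = b * F X Y"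
    using B(2) unfolding B6_class_def by blast
  have B_zero: "B i X Y = 0" if "i \<in> {5..10}" "\<And>X Y. \<Xi> i X Y = 0" "X \<in> H" "Y \<in> H" for i X Y
    using \<Xi>[OF that(1), of X \<zeta> Y] that by (simp add: g_simps \<eta>_\<zeta> hor_H H_iff)
  have \<Xi>_zero: "\<Xi> i X Y = 0" if "i \<in> {5..10}" "\<And>X Y. X \<in> H \<Longrightarrow> Y \<in> H \<Longrightarrow> B i X Y = 0" for i X Y
    using \<Xi>[OF that(1), of X Y] that(2) by (intro g_nondegenerate) simp
  show ?thesis
  proof (rule that[OF B(3,4), of a b])
    fix X Y assume XY: "X \<in> H" "Y \<in> H"
    have "{5..10::nat} = {5,6,7,8,9,10}" by auto
    then show "- \<eta> (\<xi> X Y) = a * g X Y + b * F X Y + B 8 X Y + B 9 X Y"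
      using sum[rule_format, of X Y] XY a b B_zero[of 7] B_zero[of 10] assms(2,3) by (simp add: hor_H)
  next
    show "a = 0 \<Longrightarrow> \<forall>X Y. \<Xi> 5 X Y = 0" using \<Xi>_zero[of 5] a by simp
    show "b = 0 \<Longrightarrow> \<forall>X Y. \<Xi> 6 X Y = 0" using \<Xi>_zero[of 6] b by simp
    show "\<forall>X Y. \<Xi> 8 X Y = 0" if "\<forall>X\<in>H. \<forall>Y\<in>H. B 8 X Y = 0"
      using \<Xi>_zero[of 8] that by simp
  qed
qed

text \<open>This is used with \<open>N = \<nabla>\<^sub>\<zeta> \<phi>\<close>, when the equation is \<open>b dF(\<zeta>, X, Y) = c F(X, Y)\<close> with \<open>c = - db(\<zeta>)\<close>.
  The term with \<open>N\<close> is the \<open>\<phi>\<close>-anti-invariant part of the left-hand side, while \<open>F\<close> is invariant, so it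
  vanishes.  What is left says that \<open>B8\<close> is proportional to the metric; being trace-free, it is zero.\<close>

lemma vertical_equation_imp:
  assumes B8: "B8 \<in> B8_class" and b: "b \<noteq> 0" and dim: "DIM('e) > 1"
    and N: "\<And>X Y. X \<in> H \<Longrightarrow> Y \<in> H \<Longrightarrow> g (\<phi> X) (N (\<phi> Y)) = - g X (N Y)"
    and eq: "\<And>X Y. X \<in> H \<Longrightarrow> Y \<in> H \<Longrightarrow>
      b * (g X (N Y) - 2 * a * F X Y - 2 * B8 X (\<phi> Y)) = c * F X Y"
  shows "\<And>X Y. X \<in> H \<Longrightarrow> Y \<in> H \<Longrightarrow> g X (N Y) = 0"
    and "\<And>X Y. X \<in> H \<Longrightarrow> Y \<in> H \<Longrightarrow> B8 X Y = 0"
    and "c = - 2 * a * b"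
proof -
  have bil: "bilinear B8" and inv: "\<And>X Y. X \<in> H \<Longrightarrow> Y \<in> H \<Longrightarrow> B8 (\<phi> X) (\<phi> Y) = B8 X Y"
    and tr: "\<And>E. orthonormal_basis_H E \<Longrightarrow> (\<Sum>e\<in>E. B8 e e) = 0"
    using B8 unfolding B8_class_def \<phi>_invariant_on_H_def by auto
  have F_inv: "F (\<phi> X) (\<phi> Y) = F X Y" if "X \<in> H" "Y \<in> H" for X Y
    using that by (simp add: F_def g_\<phi>_\<phi>_H)
  show N0: "g X (N Y) = 0" if "X \<in> H" "Y \<in> H" for X Y
  proof -
    have "b * (- g X (N Y) - 2 * a * F X Y - 2 * B8 X (\<phi> Y)) = c * F X Y"
      using eq[of "\<phi> X" "\<phi> Y"] that N inv[of X "\<phi> Y"] F_inv by simp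
    then have "b * (2 * g X (N Y)) = 0" using eq[OF that] by algebra
    then show ?thesis using b by simp
  qed
  have prop8: "2 * b * B8 X Y = - (c + 2 * a * b) * g X Y" if "X \<in> H" "Y \<in> H" for X Y
  proof -
    have "b * (2 * a * g X Y + 2 * B8 X Y) = - c * g X Y"
      using eq[of X "\<phi> Y"] N0[of X "\<phi> Y"] that
      by (simp add: F_def \<phi>_\<phi>_H bilinear_rneg[OF bil] g_simps)
    then show ?thesis by (simp add: algebra_simps)
  qed
  obtain E where E: "orthonormal_basis_H E" "card E + 1 = DIM('e)" using ex_orthonormal_basis_H .
  have "0 = (\<Sum>e\<in>E. 2 * b * B8 e e)" using tr[OF E(1)] by (simp add: sum_distrib_left[symmetric])
  also have "\<dots> = (\<Sum>e\<in>E. - (c + 2 * a * b))"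
    using E(1) prop8 unfolding orthonormal_basis_H_def by (intro sum.cong) auto
  finally have "card E = 0 \<or> c + 2 * a * b = 0" by auto
  then show "c = - 2 * a * b" using E(2) dim by auto
  then show "B8 X Y = 0" if "X \<in> H" "Y \<in> H" for X Y
    using prop8[OF that] b by simp
qed

end


section \<open>The Levi-Civita connection\<close>

lemma frechet_derivative_linear_apply:
  fixes \<alpha> :: "'a::real_normed_vector \<Rightarrow> 'b::euclidean_space \<Rightarrow> 'c::real_normed_vector"
  assumes "open S" "x \<in> S" "\<And>y. y \<in> S \<Longrightarrow> linear (\<alpha> y)"
    and "\<And>w. (\<lambda>y. \<alpha> y w) differentiable (at x)" "W differentiable (at x)"
  shows "frechet_derivative (\<lambda>y. \<alpha> y (W y)) (at x) u =
    frechet_derivative (\<lambda>y. \<alpha> y (W x)) (at x) u + \<alpha> x (frechet_derivative W (at x) u)"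
  using frechet_derivative_eqI[OF has_derivative_linear_apply[OF assms]] by simp

text \<open>Riesz representation with respect to an inner product other than that of the type.\<close>

lemma positive_bilinear_representation:
  fixes h :: "'a::euclidean_space \<Rightarrow> 'a \<Rightarrow> real"
  assumes h: "bilinear h" and pos: "\<And>X. X \<noteq> 0 \<Longrightarrow> h X X > 0" and f: "linear f"
  shows "\<exists>W. \<forall>Z. h W Z = f Z"
proof -
  define L where "L W = (\<Sum>i\<in>Basis. h W i *\<^sub>R i)" for W
  have ext: "h W = k" if "linear k" "\<And>i. i \<in> Basis \<Longrightarrow> h W i = k i" for W k
    using linear_eq_stdbasis[of "h W" k] that h by (auto simp: bilinear_def)
  have "linear L"
    by (rule linearI) (simp_all add: L_def bilinear_ladd[OF h] bilinear_lmul[OF h]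
        scaleR_left_distrib sum.distrib scaleR_sum_right)
  moreover have "inj L"
  proof (subst linear_injective_0[OF \<open>linear L\<close>], intro allI impI)
    fix W assume "L W = 0"
    then have "h W i = 0" if "i \<in> Basis" for i
      using that by (metis L_def inner_sum_left_Basis inner_zero_left)
    then have "h W = (\<lambda>Z. 0)" by (intro ext) (auto simp: linear_iff)
    then show "W = 0" using pos[of W] by auto
  qed
  ultimately have "surj L" by (intro linear_inj_imp_surj)
  then obtain W where W: "L W = (\<Sum>i\<in>Basis. f i *\<^sub>R i)" by (metis surjD)
  have "h W i = f i" if "i \<in> Basis" for i
    using arg_cong[OF W, of "\<lambda>V. V \<bullet> i"] that by (simp add: L_def)
  then have "h W = f" by (intro ext f)
  then show ?thesis by auto
qed

text \<open>The Koszul formula: the Christoffel symbols have to satisfy \<open>\<langle>\<Gamma>(X, Y), Z\<rangle> = K(X, Y, Z)\<close>, where \<open>K\<close> is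
  built from the derivatives of the metric, and conversely the vector that represents \<open>K(X, Y, \<cdot>)\<close> is
  a symmetric and metric connection.  So the definite description denotes.\<close>

lemma levi_civita_properties:
  fixes g :: "'e::euclidean_space \<Rightarrow> 'e \<Rightarrow> 'e \<Rightarrow> real"
  assumes S: "open S" "x \<in> S" and bil: "\<And>y. y \<in> S \<Longrightarrow> bilinear (g y)"
    and sym: "\<And>y X Y. y \<in> S \<Longrightarrow> g y X Y = g y Y X"
    and pos: "\<And>X. X \<noteq> 0 \<Longrightarrow> g x X X > 0"
    and diff: "\<And>X Y. (\<lambda>y. g y X Y) differentiable (at x)"
  shows "bilinear (levi_civita g x)"
    and "levi_civita g x X Y = levi_civita g x Y X"
    and "frechet_derivative (\<lambda>y. g y Y Z) (at x) X =
      g x (levi_civita g x X Y) Z + g x Y (levi_civita g x X Z)"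
proof -
  define D where "D X Y Z = frechet_derivative (\<lambda>y. g y Y Z) (at x) X" for X Y Z
  note gx = bil[OF S(2)]
  have D_sym: "D X Y Z = D X Z Y" for X Y Z
    using frechet_derivative_cong_open[OF S, of "\<lambda>y. g y Y Z" "\<lambda>y. g y Z Y"] sym
    by (simp add: D_def)
  have D1: "linear (\<lambda>X. D X Y Z)" for Y Z
    unfolding D_def using linear_frechet_derivative[OF diff] by simp
  have D3: "linear (\<lambda>Z. D X Y Z)" for X Y
  proof (rule linearI)
    fix Z Z' :: 'e and c :: real
    have "D X Y (Z + Z') = frechet_derivative (\<lambda>y. g y Y Z + g y Y Z') (at x) X"
      unfolding D_def
      by (intro fun_cong[OF frechet_derivative_cong_open[OF S]] bilinear_radd[OF bil])
    then show "D X Y (Z + Z') = D X Y Z + D X Y Z'"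
      unfolding D_def using frechet_derivative_add[OF diff diff] by simp
    have "D X Y (c *\<^sub>R Z) = frechet_derivative (\<lambda>y. c *\<^sub>R g y Y Z) (at x) X"
      unfolding D_def
      by (intro fun_cong[OF frechet_derivative_cong_open[OF S]] bilinear_rmul[OF bil])
    then show "D X Y (c *\<^sub>R Z) = c *\<^sub>R D X Y Z"
      unfolding D_def
      using bounded_linear.frechet_derivative_compose[OF bounded_linear_scaleR_right diff] by metis
  qed
  have D2: "linear (\<lambda>Y. D X Y Z)" for X Z
    using D3[of X Z] by (simp add: D_sym[of X _ Z])
  note lin_D = linear_add[OF D1] linear_add[OF D2] linear_add[OF D3]
    linear_cmul[OF D1] linear_cmul[OF D2] linear_cmul[OF D3]
  note g_lin = bilinear_ladd[OF gx] bilinear_radd[OF gx] bilinear_lmul[OF gx] bilinear_rmul[OF gx]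
    bilinear_lsub[OF gx]
  define K where "K X Y Z = (D X Y Z + D Y X Z - D Z X Y) / 2" for X Y Z
  have K_lin: "linear (K X Y)" for X Y
    by (rule linearI) (simp_all add: K_def lin_D algebra_simps add_divide_distrib diff_divide_distrib)
  have "\<exists>W. \<forall>Z. g x W Z = K X Y Z" for X Y
    using positive_bilinear_representation[OF gx pos K_lin] .
  then obtain \<Gamma> where \<Gamma>: "g x (\<Gamma> X Y) Z = K X Y Z" for X Y Z by metis
  have nondeg: "V = W" if "\<And>Z. g x V Z = g x W Z" for V W
    using pos[of "V - W"] that[of "V - W"] by (auto simp: g_lin)
  have "bilinear \<Gamma>"
    unfolding bilinear_def
    by (intro conjI allI linearI; rule nondeg)
      (simp_all add: g_lin \<Gamma> K_def lin_D algebra_simps add_divide_distrib diff_divide_distrib)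
  moreover have "\<Gamma> X Y = \<Gamma> Y X" for X Y
    by (rule nondeg) (simp add: \<Gamma> K_def D_sym[of _ X Y])
  moreover have metric: "D X Y Z = g x (\<Gamma> X Y) Z + g x Y (\<Gamma> X Z)" for X Y Z
    using sym[OF S(2), of Y] D_sym[of X Y Z] D_sym[of Z X Y] D_sym[of Y X Z]
    by (simp add: \<Gamma> K_def field_simps)
  ultimately have ex: "bilinear \<Gamma> \<and> (\<forall>X Y. \<Gamma> X Y = \<Gamma> Y X) \<and>
     (\<forall>X Y Z. frechet_derivative (\<lambda>y. g y Y Z) (at x) X = g x (\<Gamma> X Y) Z + g x Y (\<Gamma> X Z))"
    (is "?P \<Gamma>") unfolding D_def by blast
  have "\<Gamma>' = \<Gamma>" if "?P \<Gamma>'" for \<Gamma>'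
  proof (intro ext nondeg)
    fix X Y Z
    have D': "D X Y Z = g x (\<Gamma>' X Y) Z + g x Y (\<Gamma>' X Z)" and s: "\<Gamma>' X Y = \<Gamma>' Y X" for X Y Z
      using that unfolding D_def by blast+
    have "K X Y Z = g x (\<Gamma>' X Y) Z"
      unfolding K_def D'
      using s[of X Y] s[of X Z] s[of Y Z] sym[OF S(2), of X] sym[OF S(2), of Y] sym[OF S(2), of Z]
      by simp
    then show "g x (\<Gamma>' X Y) Z = g x (\<Gamma> X Y) Z" using \<Gamma> by simp
  qed
  then have "levi_civita g x = \<Gamma>"
    unfolding levi_civita_def using ex by (intro the_equality) blast+
  then show "bilinear (levi_civita g x)" "levi_civita g x X Y = levi_civita g x Y X"
    "frechet_derivative (\<lambda>y. g y Y Z) (at x) X =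
      g x (levi_civita g x X Y) Z + g x Y (levi_civita g x X Z)"
    using ex by simp_all
qed

section \<open>Covariant derivatives of the structure tensors in a chart\<close>

locale almost_contact_metric_domain =
  fixes U :: "'e::euclidean_space set"
    and \<phi> :: "'e \<Rightarrow> 'e \<Rightarrow> 'e" and \<zeta> :: "'e \<Rightarrow> 'e"
    and \<eta> :: "'e \<Rightarrow> 'e \<Rightarrow> real" and g :: "'e \<Rightarrow> 'e \<Rightarrow> 'e \<Rightarrow> real"
  assumes open_U: "open U"
    and acm: "x \<in> U \<Longrightarrow> almost_contact_metric_vector_space (\<phi> x) (\<zeta> x) (\<eta> x) (g x)"
    and smooth_\<phi>: "smooth_on U (\<lambda>x. \<phi> x v)"
    and smooth_\<zeta>: "smooth_on U \<zeta>"
    and smooth_\<eta>: "smooth_on U (\<lambda>x. \<eta> x v)"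
    and smooth_g: "smooth_on U (\<lambda>x. g x v w)"
begin

abbreviation horizontal :: "'e \<Rightarrow> 'e set" where
  "horizontal x \<equiv> almost_contact_metric_vector_space.H (\<zeta> x) (g x)"

abbreviation horizontal_part :: "'e \<Rightarrow> 'e \<Rightarrow> 'e" where
  "horizontal_part x \<equiv> almost_contact_metric_vector_space.hor (\<zeta> x) (\<eta> x)"

abbreviation fundamental_form :: "'e \<Rightarrow> 'e \<Rightarrow> 'e \<Rightarrow> real" where
  "fundamental_form x X Y \<equiv> g x X (\<phi> x Y)"

definition d_eta :: "'e \<Rightarrow> 'e \<Rightarrow> 'e \<Rightarrow> real" where
  "d_eta x X Y = frechet_derivative (\<lambda>y. \<eta> y Y) (at x) X - frechet_derivative (\<lambda>y. \<eta> y X) (at x) Y"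

definition d_F :: "'e \<Rightarrow> 'e \<Rightarrow> 'e \<Rightarrow> 'e \<Rightarrow> real" where
  "d_F x X Y Z = frechet_derivative (\<lambda>y. fundamental_form y Y Z) (at x) X +
     frechet_derivative (\<lambda>y. fundamental_form y Z X) (at x) Y +
     frechet_derivative (\<lambda>y. fundamental_form y X Y) (at x) Z"

lemma C_k_\<phi>: "C_k_on k U (\<lambda>x. \<phi> x v)" and C_k_\<zeta>: "C_k_on k U \<zeta>"
  and C_k_\<eta>: "C_k_on k U (\<lambda>x. \<eta> x v)" and C_k_g: "C_k_on k U (\<lambda>x. g x v w)"
  using smooth_\<phi> smooth_\<zeta> smooth_\<eta> smooth_g by (auto simp: smooth_on_def)

lemma linear_\<phi>: "x \<in> U \<Longrightarrow> linear (\<phi> x)" and linear_\<eta>: "x \<in> U \<Longrightarrow> linear (\<eta> x)"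
  and bilinear_g: "x \<in> U \<Longrightarrow> bilinear (g x)" and linear_g: "x \<in> U \<Longrightarrow> linear (g x X)"
  using acm by (auto simp: almost_contact_metric_vector_space_def bilinear_def)

lemma C_k_F: "C_k_on k U (\<lambda>x. fundamental_form x X Y)"
  by (rule C_k_on_linear_apply[where \<alpha> = "\<lambda>x. g x X"])
    (auto intro: open_U linear_g C_k_g C_k_\<phi>)

lemma C_k_d_eta: "C_k_on k U (\<lambda>x. d_eta x X Y)"
  unfolding d_eta_def diff_conv_add_uminus
  using C_k_\<eta>[of "Suc k"]
  by (intro C_k_on_add open_U C_k_on_bounded_linear[OF bounded_linear_minus]) auto

text \<open>The identity \<open>d(d\<eta>) = 0\<close> comes from the symmetry of second derivatives.\<close>

lemma d_d_eta:
  assumes x: "x \<in> U"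
  shows "frechet_derivative (\<lambda>y. d_eta y Y Z) (at x) X +
     frechet_derivative (\<lambda>y. d_eta y Z X) (at x) Y +
     frechet_derivative (\<lambda>y. d_eta y X Y) (at x) Z = 0"
proof -
  have *: "frechet_derivative (\<lambda>y. d_eta y Y Z) (at x) X =
     frechet_derivative (\<lambda>y. frechet_derivative (\<lambda>y. \<eta> y Z) (at y) Y) (at x) X -
     frechet_derivative (\<lambda>y. frechet_derivative (\<lambda>y. \<eta> y Y) (at y) Z) (at x) X" for X Y Z
  proof -
    have "(\<lambda>y. frechet_derivative (\<lambda>y. \<eta> y V) (at y) W) differentiable (at x)" for V W
      using C_k_\<eta>[of 2 V] x by (simp add: numeral_2_eq_2)
    then show ?thesis
      unfolding d_eta_def
      by (subst frechet_derivative_eqI[OF has_derivative_diff[OF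
              frechet_derivative_works[THEN iffD1] frechet_derivative_works[THEN iffD1]]]) auto
  qed
  show ?thesis
    using second_derivative_symmetric[OF open_U x C_k_\<eta>] unfolding * by (simp add: algebra_simps)
qed

context
  fixes x assumes x: "x \<in> U"
begin

interpretation P: almost_contact_metric_vector_space "\<phi> x" "\<zeta> x" "\<eta> x" "g x"
  using acm[OF x] .

lemma diff_\<phi>: "(\<lambda>y. \<phi> y v) differentiable (at x)" and diff_\<zeta>: "\<zeta> differentiable (at x)"
  and diff_\<eta>: "(\<lambda>y. \<eta> y v) differentiable (at x)" and diff_g: "(\<lambda>y. g y v w) differentiable (at x)"
  using C_k_\<phi>[of 1] C_k_\<zeta>[of 1] C_k_\<eta>[of 1] C_k_g[of 1] x by auto

lemma connection_bilinear: "bilinear (levi_civita g x)"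
  and connection_symmetric: "levi_civita g x X Y = levi_civita g x Y X"
  and connection_metric: "frechet_derivative (\<lambda>y. g y Y Z) (at x) X =
      g x (levi_civita g x X Y) Z + g x Y (levi_civita g x X Z)"
proof -
  have 1: "g y X Y = g y Y X" if "y \<in> U" for y X Y
    using almost_contact_metric_vector_space.g_symmetric[OF acm[OF that]] .
  note lc = levi_civita_properties[OF open_U x bilinear_g 1 P.g_positive diff_g]
  show "bilinear (levi_civita g x)" "levi_civita g x X Y = levi_civita g x Y X"
    "frechet_derivative (\<lambda>y. g y Y Z) (at x) X =
      g x (levi_civita g x X Y) Z + g x Y (levi_civita g x X Z)"
    by (rule lc; assumption)+
qed

lemmas connection_simps = bilinear_ladd[OF connection_bilinear] bilinear_radd[OF connection_bilinear]
  bilinear_lmul[OF connection_bilinear] bilinear_rmul[OF connection_bilinear]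
  bilinear_rneg[OF connection_bilinear] bilinear_rsub[OF connection_bilinear]

text \<open>The next four lemmas are the derivatives of the identities \<open>\<eta> = \<langle>\<cdot>, \<zeta>\<rangle>\<close>, \<open>\<eta>(\<zeta>) = 1\<close>, \<open>\<phi> \<zeta> = 0\<close> and
  \<open>\<phi>\<^sup>2 = - I + \<eta> \<otimes> \<zeta>\<close>.\<close>

lemma nabla_form_eq: "nabla_form g \<eta> x X Y = g x Y (nabla_vector g \<zeta> x X)"
proof -
  have "frechet_derivative (\<lambda>y. \<eta> y Y) (at x) X = frechet_derivative (\<lambda>y. g y Y (\<zeta> y)) (at x) X"
    by (intro fun_cong[OF frechet_derivative_cong_open[OF open_U x]])
      (simp add: almost_contact_metric_vector_space.g_\<zeta>_right[OF acm])
  also have "\<dots> = frechet_derivative (\<lambda>y. g y Y (\<zeta> x)) (at x) X + g x Y (frechet_derivative \<zeta> (at x) X)"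
    by (rule frechet_derivative_linear_apply[where \<alpha> = "\<lambda>y. g y Y"])
      (use open_U x linear_g diff_g diff_\<zeta> in auto)
  finally show ?thesis
    by (simp add: nabla_form_def nabla_vector_def connection_metric P.g_\<zeta>_right P.g_simps)
qed

lemma \<eta>_nabla_\<zeta>: "\<eta> x (nabla_vector g \<zeta> x X) = 0"
proof -
  have "frechet_derivative (\<lambda>y. \<eta> y (\<zeta> y)) (at x) X = frechet_derivative (\<lambda>y. 1) (at x) X"
    by (intro fun_cong[OF frechet_derivative_cong_open[OF open_U x]])
      (simp add: almost_contact_metric_vector_space.\<eta>_\<zeta>[OF acm])
  moreover have "frechet_derivative (\<lambda>y. \<eta> y (\<zeta> y)) (at x) X =
      frechet_derivative (\<lambda>y. \<eta> y (\<zeta> x)) (at x) X + \<eta> x (frechet_derivative \<zeta> (at x) X)"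
    by (rule frechet_derivative_linear_apply) (use open_U x linear_\<eta> diff_\<eta> diff_\<zeta> in auto)
  ultimately have "nabla_form g \<eta> x X (\<zeta> x) = - \<eta> x (nabla_vector g \<zeta> x X)"
    by (simp add: nabla_form_def nabla_vector_def P.\<eta>_simps)
  then show ?thesis using nabla_form_eq[of X "\<zeta> x"] by (simp add: P.g_\<zeta>)
qed

lemma nabla_\<phi>_\<zeta>: "nabla_endo g \<phi> x X (\<zeta> x) = - \<phi> x (nabla_vector g \<zeta> x X)"
proof -
  have "frechet_derivative (\<lambda>y. \<phi> y (\<zeta> y)) (at x) X = frechet_derivative (\<lambda>y. 0) (at x) X"
    by (intro fun_cong[OF frechet_derivative_cong_open[OF open_U x]])
      (simp add: almost_contact_metric_vector_space.\<phi>_\<zeta>[OF acm])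
  moreover have "frechet_derivative (\<lambda>y. \<phi> y (\<zeta> y)) (at x) X =
      frechet_derivative (\<lambda>y. \<phi> y (\<zeta> x)) (at x) X + \<phi> x (frechet_derivative \<zeta> (at x) X)"
    by (rule frechet_derivative_linear_apply) (use open_U x linear_\<phi> diff_\<phi> diff_\<zeta> in auto)
  ultimately have "frechet_derivative (\<lambda>y. \<phi> y (\<zeta> x)) (at x) X = - \<phi> x (frechet_derivative \<zeta> (at x) X)"
    by (simp add: eq_neg_iff_add_eq_0)
  then show ?thesis
    using bilinear_rzero[OF connection_bilinear]
    by (simp add: nabla_endo_def nabla_vector_def P.\<phi>_\<zeta> P.\<phi>_simps)
qed

lemma nabla_\<phi>_\<phi>:
  "nabla_endo g \<phi> x X (\<phi> x Y) + \<phi> x (nabla_endo g \<phi> x X Y) =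
    nabla_form g \<eta> x X Y *\<^sub>R \<zeta> x + \<eta> x Y *\<^sub>R nabla_vector g \<zeta> x X"
proof -
  have "frechet_derivative (\<lambda>y. \<phi> y (\<phi> y Y)) (at x) X =
      frechet_derivative (\<lambda>y. - Y + \<eta> y Y *\<^sub>R \<zeta> y) (at x) X"
    by (intro fun_cong[OF frechet_derivative_cong_open[OF open_U x]])
      (simp add: almost_contact_metric_vector_space.\<phi>_\<phi>[OF acm])
  also have "\<dots> = frechet_derivative (\<lambda>y. \<eta> y Y *\<^sub>R \<zeta> y) (at x) X"
    using diff_\<eta>[of Y] diff_\<zeta> by (subst frechet_derivative_add) (auto intro: differentiable_scaleR)
  also have "\<dots> = \<eta> x Y *\<^sub>R frechet_derivative \<zeta> (at x) X + frechet_derivative (\<lambda>y. \<eta> y Y) (at x) X *\<^sub>R \<zeta> x"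
    by (rule bounded_bilinear.frechet_derivative_prod[OF bounded_bilinear_scaleR diff_\<eta> diff_\<zeta>])
  finally have 1: "frechet_derivative (\<lambda>y. \<phi> y (\<phi> y Y)) (at x) X = \<dots>" .
  have "frechet_derivative (\<lambda>y. \<phi> y (\<phi> y Y)) (at x) X =
      frechet_derivative (\<lambda>y. \<phi> y (\<phi> x Y)) (at x) X + \<phi> x (frechet_derivative (\<lambda>y. \<phi> y Y) (at x) X)"
    by (rule frechet_derivative_linear_apply) (use open_U x linear_\<phi> diff_\<phi> in auto)
  then have "frechet_derivative (\<lambda>y. \<phi> y (\<phi> x Y)) (at x) X =
      \<eta> x Y *\<^sub>R frechet_derivative \<zeta> (at x) X + frechet_derivative (\<lambda>y. \<eta> y Y) (at x) X *\<^sub>R \<zeta> x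
      - \<phi> x (frechet_derivative (\<lambda>y. \<phi> y Y) (at x) X)" using 1 by simp
  then show ?thesis
    by (simp add: nabla_endo_def nabla_form_def nabla_vector_def P.\<phi>_simps P.\<phi>_\<phi> P.\<eta>_simps
        connection_simps algebra_simps)
qed

lemma derivative_F:
  "frechet_derivative (\<lambda>y. fundamental_form y Y Z) (at x) X =
    g x Y (nabla_endo g \<phi> x X Z) + fundamental_form x (levi_civita g x X Y) Z +
    fundamental_form x Y (levi_civita g x X Z)"
proof -
  have "frechet_derivative (\<lambda>y. fundamental_form y Y Z) (at x) X =
      frechet_derivative (\<lambda>y. g y Y (\<phi> x Z)) (at x) X + g x Y (frechet_derivative (\<lambda>y. \<phi> y Z) (at x) X)"
    by (rule frechet_derivative_linear_apply[where \<alpha> = "\<lambda>y. g y Y"])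
      (use open_U x linear_g diff_g diff_\<phi> in auto)
  then show ?thesis by (simp add: connection_metric nabla_endo_def P.g_simps)
qed

text \<open>As the connection is torsion-free, the Christoffel symbols cancel in exterior derivatives.\<close>

lemma d_eta_eq: "d_eta x X Y = nabla_form g \<eta> x X Y - nabla_form g \<eta> x Y X"
  using connection_symmetric[of X Y] by (simp add: d_eta_def nabla_form_def)

lemma d_F_eq:
  "d_F x X Y Z = g x Y (nabla_endo g \<phi> x X Z) + g x Z (nabla_endo g \<phi> x Y X) +
    g x X (nabla_endo g \<phi> x Z Y)"
  using P.F_skew[unfolded P.F_def, of Y "levi_civita g x X Z"]
    P.F_skew[unfolded P.F_def, of Z "levi_civita g x X Y"]
    P.F_skew[unfolded P.F_def, of X "levi_civita g x Y Z"]
  unfolding d_F_def derivative_F connection_symmetric[of Y X] connection_symmetric[of Z X]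
    connection_symmetric[of Z Y]
  by linarith

text \<open>With the following lemmas the covariant derivatives of \<open>\<eta>\<close> and \<open>\<phi>\<close>, and thereby \<open>d\<eta>\<close> and \<open>dF\<close>, are
  expressed by the intrinsic torsion.\<close>

lemma torsion_\<eta>: "\<eta> x (intrinsic_torsion \<phi> \<zeta> \<eta> g x X Y) = nabla_form g \<eta> x X Y"
  unfolding intrinsic_torsion_def
  by (simp add: P.\<eta>_simps P.\<eta>_\<phi> P.\<eta>_\<zeta> \<eta>_nabla_\<zeta>)

lemma torsion_\<zeta>_\<zeta>: "intrinsic_torsion \<phi> \<zeta> \<eta> g x (\<zeta> x) (\<zeta> x) = - nabla_vector g \<zeta> x (\<zeta> x)"
proof -
  have "nabla_form g \<eta> x (\<zeta> x) (\<zeta> x) = 0" by (simp add: nabla_form_eq P.g_\<zeta> \<eta>_nabla_\<zeta>)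
  then have "intrinsic_torsion \<phi> \<zeta> \<eta> g x (\<zeta> x) (\<zeta> x) =
      - ((1/2) *\<^sub>R nabla_vector g \<zeta> x (\<zeta> x) + (1/2) *\<^sub>R nabla_vector g \<zeta> x (\<zeta> x))"
    unfolding intrinsic_torsion_def
    by (simp add: nabla_\<phi>_\<zeta> P.\<phi>_simps P.\<phi>_\<phi> \<eta>_nabla_\<zeta> P.\<eta>_\<zeta>)
  then show ?thesis by (simp only: scaleR_add_left[symmetric]) simp
qed

lemma torsion_horizontal:
  assumes "Y \<in> horizontal x"
  shows "horizontal_part x (intrinsic_torsion \<phi> \<zeta> \<eta> g x X Y) = - (1/2) *\<^sub>R \<phi> x (nabla_endo g \<phi> x X Y)"
proof -
  have "\<eta> x Y = 0" using assms by (simp add: P.H_iff)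
  then show ?thesis
    unfolding P.hor_def intrinsic_torsion_def by (simp add: P.\<eta>_simps P.\<eta>_\<phi> P.\<eta>_\<zeta>)
qed

lemma nabla_\<phi>_horizontal:
  assumes "Y \<in> horizontal x" "Z \<in> horizontal x"
  shows "g x Y (nabla_endo g \<phi> x X Z) =
    - 2 * g x (horizontal_part x (intrinsic_torsion \<phi> \<zeta> \<eta> g x X Z)) (\<phi> x Y)"
proof -
  have "g x (\<phi> x (nabla_endo g \<phi> x X Z)) (\<phi> x Y) = g x Y (nabla_endo g \<phi> x X Z)"
    using assms(1) P.g_symmetric[of Y] by (simp add: P.g_\<phi>_\<phi> P.H_iff)
  then show ?thesis by (simp add: torsion_horizontal[OF assms(2)] P.g_simps)
qed

lemma nabla_\<phi>_\<zeta>_right: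
  "g x Y (nabla_endo g \<phi> x X (\<zeta> x)) = nabla_form g \<eta> x X (\<phi> x Y)"
  by (simp add: nabla_\<phi>_\<zeta> nabla_form_eq P.g_simps P.g_\<phi>_left)

lemma nabla_\<phi>_\<zeta>_left:
  assumes "Z \<in> horizontal x"
  shows "g x (\<zeta> x) (nabla_endo g \<phi> x X Z) = - nabla_form g \<eta> x X (\<phi> x Z)"
proof -
  have "\<eta> x (nabla_endo g \<phi> x X (\<phi> x (\<phi> x Z))) = nabla_form g \<eta> x X (\<phi> x Z)"
    using arg_cong[OF nabla_\<phi>_\<phi>[of X "\<phi> x Z"], of "\<eta> x"]
    by (simp add: P.\<eta>_simps P.\<eta>_\<phi> P.\<eta>_\<zeta>)
  moreover have "nabla_endo g \<phi> x X (- Z) = - nabla_endo g \<phi> x X Z"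
  proof -
    have "frechet_derivative (\<lambda>y. \<phi> y (- Z)) (at x) X = frechet_derivative (\<lambda>y. - \<phi> y Z) (at x) X"
      by (intro fun_cong[OF frechet_derivative_cong_open[OF open_U x]] linear_neg linear_\<phi>)
    also have "\<dots> = - frechet_derivative (\<lambda>y. \<phi> y Z) (at x) X"
      by (rule bounded_linear.frechet_derivative_compose[OF bounded_linear_minus[OF bounded_linear_ident] diff_\<phi>])
    finally show ?thesis by (simp add: nabla_endo_def P.\<phi>_simps connection_simps)
  qed
  ultimately show ?thesis using assms by (simp add: P.\<phi>_\<phi>_H P.g_\<zeta> P.\<eta>_simps)
qed

end

end


section \<open>The consequences of \<open>d\<eta> = - 2 b F\<close> in a chart\<close>

context almost_contact_metric_domain
begin

text \<open>The factor \<open>b\<close> with \<open>d\<eta> = - 2 b F\<close> if there is one; for the torsion types considered below it is the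
  factor of \<open>F\<close> in the part \<open>B\<^sub>6\<close> of the intrinsic torsion.  A description by \<open>d\<eta>\<close> and \<open>F\<close>, rather than by
  the torsion, makes its smoothness and its independence of the chart evident.\<close>

definition contact_coefficient :: "'e \<Rightarrow> real" where
  "contact_coefficient x = (SOME b. \<forall>X Y. d_eta x X Y = - 2 * b * fundamental_form x X Y)"

end

text \<open>A structure of type \<open>\<C>\<^sub>1 \<oplus> \<C>\<^sub>2 \<oplus> \<C>\<^sub>3 \<oplus> \<C>\<^sub>5 \<oplus> \<C>\<^sub>6 \<oplus> \<C>\<^sub>8 \<oplus> \<C>\<^sub>9 \<oplus> \<C>\<^sub>1\<^sub>1\<close> in a chart.\<close>

locale torsion_type_domain = almost_contact_metric_domain U \<phi> \<zeta> \<eta> g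
  for U :: "'e::euclidean_space set" and \<phi> \<zeta> \<eta> g +
  fixes \<Xi> :: "nat \<Rightarrow> 'e \<Rightarrow> 'e \<Rightarrow> 'e \<Rightarrow> 'e"
  assumes components: "x \<in> U \<Longrightarrow>
      almost_contact_metric_vector_space.torsion_components (\<phi> x) (\<zeta> x) (\<eta> x) (g x)
        (intrinsic_torsion \<phi> \<zeta> \<eta> g x) (\<lambda>i. \<Xi> i x)"
    and zero: "x \<in> U \<Longrightarrow> i \<in> {4, 7, 10, 12} \<Longrightarrow> \<Xi> i x X Y = 0"
    and dim: "DIM('e) > 3"
begin

abbreviation b where "b \<equiv> contact_coefficient"

context
  fixes x assumes x: "x \<in> U"
begin

interpretation P: almost_contact_metric_vector_space "\<phi> x" "\<zeta> x" "\<eta> x" "g x"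
  using acm[OF x] .

text \<open>Since \<open>\<xi>\<^sub>\<zeta> \<zeta> = - \<nabla>\<^sub>\<zeta> \<zeta>\<close>, the vanishing of the component of index \<open>12\<close> means that \<open>\<nabla>\<^sub>\<zeta> \<eta> = 0\<close>.\<close>

lemma nabla_form_\<zeta>: "nabla_form g \<eta> x (\<zeta> x) Y = 0"
proof -
  let ?\<xi> = "intrinsic_torsion \<phi> \<zeta> \<eta> g x"
  have "\<Xi> 12 x (\<zeta> x) Y = \<eta> x (\<zeta> x) *\<^sub>R
      (\<eta> x Y *\<^sub>R ?\<xi> (\<zeta> x) (\<zeta> x) - g x (?\<xi> (\<zeta> x) (\<zeta> x)) Y *\<^sub>R \<zeta> x)"
    using components[OF x] unfolding P.torsion_components_def by blast
  then have "\<eta> x Y *\<^sub>R ?\<xi> (\<zeta> x) (\<zeta> x) = g x (?\<xi> (\<zeta> x) (\<zeta> x)) Y *\<^sub>R \<zeta> x"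
    using zero[OF x, of 12] by (simp add: P.\<eta>_\<zeta>)
  from arg_cong[OF this, of "\<eta> x"] show ?thesis
    using P.g_symmetric[of Y] by (simp add: torsion_\<zeta>_\<zeta>[OF x] P.\<eta>_simps P.\<eta>_\<zeta> \<eta>_nabla_\<zeta>[OF x]
        P.g_simps nabla_form_eq[OF x])
qed

lemma nabla_form_hor: "nabla_form g \<eta> x X Y = nabla_form g \<eta> x (P.hor X) (P.hor Y)"
proof -
  have lin: "nabla_vector g \<zeta> x (P.hor X) = nabla_vector g \<zeta> x X - \<eta> x X *\<^sub>R nabla_vector g \<zeta> x (\<zeta> x)"
    using linear_frechet_derivative[OF diff_\<zeta>[OF x]] connection_bilinear[OF x]
    by (simp add: nabla_vector_def P.hor_def linear_diff linear_cmul bilinear_lsub bilinear_lmul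
        scaleR_add_right)
  have "g x (P.hor Y) (nabla_vector g \<zeta> x (\<zeta> x)) = 0"
    using nabla_form_\<zeta>[of "P.hor Y"] by (simp add: nabla_form_eq[OF x])
  then show ?thesis
    unfolding nabla_form_eq[OF x] lin
    by (simp add: P.g_simps) (simp add: P.hor_def P.g_simps P.g_\<zeta> \<eta>_nabla_\<zeta>[OF x])
qed

text \<open>The skew part of \<open>\<nabla>\<eta>\<close> comes from \<open>B\<^sub>6\<close> alone, so \<open>d\<eta>\<close> is a multiple of \<open>F\<close>.  In \<open>dF(\<zeta>, X, Y)\<close>, the expression
  \<open>- B(X, \<phi> Y) + B(Y, \<phi> X)\<close> is the contribution of \<open>\<nabla>\<eta>\<close>; the parts \<open>B\<^sub>6\<close> and \<open>B\<^sub>9\<close> cancel in it.\<close>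

lemma pointwise_equations:
  obtains a B8 where "B8 \<in> P.B8_class"
    and "\<And>X Y. d_eta x X Y = - 2 * b x * fundamental_form x X Y"
    and "\<And>X Y. X \<in> horizontal x \<Longrightarrow> Y \<in> horizontal x \<Longrightarrow> d_F x (\<zeta> x) X Y =
      g x X (nabla_endo g \<phi> x (\<zeta> x) Y) - 2 * a * fundamental_form x X Y - 2 * B8 X (\<phi> x Y)"
    and "a = 0 \<Longrightarrow> \<forall>X Y. \<Xi> 5 x X Y = 0" and "b x = 0 \<Longrightarrow> \<forall>X Y. \<Xi> 6 x X Y = 0"
    and "\<forall>X\<in>horizontal x. \<forall>Y\<in>horizontal x. B8 X Y = 0 \<Longrightarrow> \<forall>X Y. \<Xi> 8 x X Y = 0"
proof -
  have z: "\<Xi> 7 x X Y = 0" "\<Xi> 10 x X Y = 0" for X Y using zero[OF x] by auto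
  obtain a \<beta> B8 B9 where B: "B8 \<in> P.B8_class" "B9 \<in> P.B9_class"
    and dec: "\<And>X Y. X \<in> P.H \<Longrightarrow> Y \<in> P.H \<Longrightarrow>
      - \<eta> x (intrinsic_torsion \<phi> \<zeta> \<eta> g x X Y) = a * g x X Y + \<beta> * P.F X Y + B8 X Y + B9 X Y"
    and vanish: "a = 0 \<Longrightarrow> \<forall>X Y. \<Xi> 5 x X Y = 0" "\<beta> = 0 \<Longrightarrow> \<forall>X Y. \<Xi> 6 x X Y = 0"
      "\<forall>X\<in>P.H. \<forall>Y\<in>P.H. B8 X Y = 0 \<Longrightarrow> \<forall>X Y. \<Xi> 8 x X Y = 0"
    by (rule P.torsion_components_mixed[OF components[OF x] z]) (rule that; assumption | simp)
  have bil: "bilinear B8" "bilinear B9" and sym: "\<And>X Y. X \<in> P.H \<Longrightarrow> Y \<in> P.H \<Longrightarrow> B8 X Y = B8 Y X"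
    "\<And>X Y. X \<in> P.H \<Longrightarrow> Y \<in> P.H \<Longrightarrow> B9 X Y = B9 Y X"
    and inv: "\<And>X Y. X \<in> P.H \<Longrightarrow> Y \<in> P.H \<Longrightarrow> B8 (\<phi> x X) (\<phi> x Y) = B8 X Y"
    "\<And>X Y. X \<in> P.H \<Longrightarrow> Y \<in> P.H \<Longrightarrow> B9 (\<phi> x X) (\<phi> x Y) = - B9 X Y"
    using B unfolding P.B8_class_def P.B9_class_def P.sym_on_H_def P.\<phi>_invariant_on_H_def
      P.\<phi>_anti_invariant_on_H_def by blast+
  have nf: "nabla_form g \<eta> x X Y = - (a * g x X Y + \<beta> * g x X (\<phi> x Y) + B8 X Y + B9 X Y)"
    if "X \<in> P.H" "Y \<in> P.H" for X Y
    using dec[OF that] by (simp add: torsion_\<eta>[OF x] P.F_def)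
  have \<phi>_hor: "\<phi> x (P.hor X) = \<phi> x X" for X
    by (simp add: P.hor_def P.\<phi>_simps P.\<phi>_\<zeta>)
  have de: "d_eta x X Y = - 2 * \<beta> * fundamental_form x X Y" for X Y
  proof -
    have "d_eta x X Y = nabla_form g \<eta> x (P.hor X) (P.hor Y) - nabla_form g \<eta> x (P.hor Y) (P.hor X)"
      using d_eta_eq[OF x] nabla_form_hor by metis
    also have "\<dots> = - \<beta> * g x (P.hor X) (\<phi> x Y) + \<beta> * g x (P.hor Y) (\<phi> x X)"
      using P.g_symmetric[of "P.hor X" "P.hor Y"] sym(1)[of "P.hor X" "P.hor Y"]
        sym(2)[of "P.hor X" "P.hor Y"]
      by (simp add: nf \<phi>_hor)
    also have "\<dots> = - \<beta> * g x X (\<phi> x Y) + \<beta> * g x Y (\<phi> x X)"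
      by (simp add: P.g_hor_left)
    finally show ?thesis using P.F_skew[of Y X] by (simp add: P.F_def)
  qed
  obtain X0 Y0 where F0: "P.F X0 Y0 \<noteq> 0"
    by (rule P.F_nonzero) (use dim in auto)
  have "\<forall>X Y. d_eta x X Y = - 2 * b x * fundamental_form x X Y"
    unfolding contact_coefficient_def by (rule someI[of _ \<beta>]) (use de in blast)
  then have "b x = \<beta>" using de[of X0 Y0] F0 by (simp add: P.F_def)
  moreover have "d_F x (\<zeta> x) X Y =
      g x X (nabla_endo g \<phi> x (\<zeta> x) Y) - 2 * a * fundamental_form x X Y - 2 * B8 X (\<phi> x Y)"
    if XY: "X \<in> P.H" "Y \<in> P.H" for X Y
  proof -
    have "B8 Y (\<phi> x X) = - B8 X (\<phi> x Y)"
      using inv(1)[of Y "\<phi> x X"] sym(1)[of X "\<phi> x Y"] XY by (simp add: P.\<phi>_\<phi>_H bilinear_rneg[OF bil(1)])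
    moreover have "B9 Y (\<phi> x X) = B9 X (\<phi> x Y)"
      using inv(2)[of Y "\<phi> x X"] sym(2)[of X "\<phi> x Y"] XY by (simp add: P.\<phi>_\<phi>_H bilinear_rneg[OF bil(2)])
    moreover have "g x Y (\<phi> x X) = - g x X (\<phi> x Y)"
      using P.F_skew[of Y X] by (simp add: P.F_def)
    ultimately have "nabla_form g \<eta> x X (\<phi> x Y) - nabla_form g \<eta> x Y (\<phi> x X) =
        - 2 * a * fundamental_form x X Y - 2 * B8 X (\<phi> x Y)"
      using XY P.g_symmetric[of X Y] by (simp add: nf P.\<phi>_\<phi>_H P.g_simps)
    then show ?thesis
      by (simp add: d_F_eq[OF x] nabla_\<phi>_\<zeta>_right[OF x] nabla_\<phi>_\<zeta>_left[OF x XY(1)])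
  qed
  ultimately show ?thesis using that[of B8 a] B(1) de vanish by simp
qed

lemma GH_components: "\<Xi> 1 x \<in> P.GH1_class" "\<Xi> 2 x \<in> P.GH2_class" "\<Xi> 3 x \<in> P.GH3_class"
  and GH_sum: "X \<in> P.H \<Longrightarrow> Y \<in> P.H \<Longrightarrow> P.hor (intrinsic_torsion \<phi> \<zeta> \<eta> g x X Y) =
      \<Xi> 1 x X Y + \<Xi> 2 x X Y + \<Xi> 3 x X Y"
proof -
  show "\<Xi> 1 x \<in> P.GH1_class" "\<Xi> 2 x \<in> P.GH2_class" "\<Xi> 3 x \<in> P.GH3_class"
    using components[OF x] unfolding P.torsion_components_def by blast+
  assume "X \<in> P.H" "Y \<in> P.H"
  moreover have "P.hor (intrinsic_torsion \<phi> \<zeta> \<eta> g x (P.hor X) (P.hor Y)) = (\<Sum>i=1..4. \<Xi> i x X Y)"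
    using components[OF x] unfolding P.torsion_components_def by blast
  moreover have "{1..4::nat} = {1,2,3,4}" by auto
  ultimately show "P.hor (intrinsic_torsion \<phi> \<zeta> \<eta> g x X Y) = \<Xi> 1 x X Y + \<Xi> 2 x X Y + \<Xi> 3 x X Y"
    using zero[OF x, of 4] by (simp add: P.hor_H)
qed

lemma d_F_horizontal:
  assumes XYZ: "X \<in> P.H" "Y \<in> P.H" "Z \<in> P.H"
  defines "S \<equiv> \<lambda>X Y. \<Xi> 1 x X Y + \<Xi> 2 x X Y + \<Xi> 3 x X Y"
  shows "d_F x X Y Z = 2 * (g x (S X Y) (\<phi> x Z) + g x (S Y Z) (\<phi> x X) + g x (S Z X) (\<phi> x Y))"
proof -
  have GH: "\<Xi> 1 x \<in> P.GH_space" "\<Xi> 2 x \<in> P.GH_space" "\<Xi> 3 x \<in> P.GH_space"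
    using GH_components unfolding P.GH1_class_def P.GH2_class_def P.GH3_class_def by auto
  have "g x Y (nabla_endo g \<phi> x X Z) = 2 * g x (S X Y) (\<phi> x Z)"
    if XYZ: "X \<in> P.H" "Y \<in> P.H" "Z \<in> P.H" for X Y Z
  proof -
    have "g x (T X Z) (\<phi> x Y) = - g x (T X Y) (\<phi> x Z)" if T: "T \<in> P.GH_space" for T
      using P.GH_space_\<phi>_shift[OF T XYZ] P.GH_space_skew[OF T XYZ(1,3) P.\<phi>_in_H[of Y]] by simp
    then show ?thesis
      using GH by (simp add: nabla_\<phi>_horizontal[OF x XYZ(2,3)] GH_sum[OF XYZ(1,3)] S_def P.g_simps)
  qed
  then show ?thesis using XYZ by (simp add: d_F_eq[OF x])
qed

end

lemma d_eta_eq_b: "x \<in> U \<Longrightarrow> d_eta x X Y = - 2 * b x * fundamental_form x X Y"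
  by (erule pointwise_equations)

text \<open>For constant \<open>X\<close> and \<open>Y\<close> with \<open>F(X, Y) \<noteq> 0\<close> at a point, \<open>b\<close> is near this point a quotient of the smooth
  functions \<open>d\<eta>(X, Y)\<close> and \<open>- 2 F(X, Y)\<close>.\<close>

lemma b_locally_C_k:
  assumes x: "x \<in> U"
  obtains V where "open V" "x \<in> V" "V \<subseteq> U" "\<forall>k. C_k_on k V b"
proof -
  interpret P: almost_contact_metric_vector_space "\<phi> x" "\<zeta> x" "\<eta> x" "g x" using acm[OF x] .
  obtain X Y where F0: "P.F X Y \<noteq> 0"
    by (rule P.F_nonzero) (use dim in auto)
  define V where "V = {y \<in> U. fundamental_form y X Y \<noteq> 0}"
  have "continuous_on U (\<lambda>y. fundamental_form y X Y)" using C_k_F[of 0] by simp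
  then have V: "open V"
    using continuous_open_preimage[OF _ open_U, of "\<lambda>y. fundamental_form y X Y" "- {0}"]
    unfolding V_def by (simp add: vimage_def Int_def open_Compl)
  have "C_k_on k V b" for k
  proof (rule C_k_on_cong[OF V])
    show "C_k_on k V (\<lambda>y. (- 1 / 2) * (d_eta y X Y * inverse (fundamental_form y X Y)))"
      by (intro C_k_on_mult C_k_on_inverse V C_k_on_const C_k_on_subset[OF C_k_d_eta]
          C_k_on_subset[OF C_k_F]) (auto simp: V_def)
    show "(- 1 / 2) * (d_eta y X Y * inverse (fundamental_form y X Y)) = b y" if "y \<in> V" for y
      using that unfolding V_def by (simp add: d_eta_eq_b)
  qed
  then show ?thesis using that V x F0 unfolding V_def P.F_def by auto
qed

lemma b_differentiable: "x \<in> U \<Longrightarrow> b differentiable (at x)"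
  by (metis C_k_on.simps(2) b_locally_C_k)

text \<open>The exterior derivative of \<open>d\<eta> = - 2 b F\<close> is \<open>0 = - 2 (db \<and> F + b dF)\<close>.\<close>

lemma d_b_wedge_F:
  assumes x: "x \<in> U"
  defines "\<theta> \<equiv> frechet_derivative b (at x)"
  shows "\<theta> X * fundamental_form x Y Z + \<theta> Y * fundamental_form x Z X + \<theta> Z * fundamental_form x X Y
    + b x * d_F x X Y Z = 0"
proof -
  have *: "frechet_derivative (\<lambda>y. d_eta y Y Z) (at x) X = - 2 *
      (b x * frechet_derivative (\<lambda>y. fundamental_form y Y Z) (at x) X + \<theta> X * fundamental_form x Y Z)" for X Y Z
  proof -
    have F: "(\<lambda>y. fundamental_form y Y Z) differentiable (at x)" using C_k_F[of 1] x by simp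
    have "frechet_derivative (\<lambda>y. d_eta y Y Z) (at x) X =
        frechet_derivative (\<lambda>y. (- 2) * (b y * fundamental_form y Y Z)) (at x) X"
      by (intro fun_cong[OF frechet_derivative_cong_open[OF open_U x]])
        (simp add: d_eta_eq_b)
    also have "\<dots> = (- 2) * frechet_derivative (\<lambda>y. b y * fundamental_form y Y Z) (at x) X"
      using b_differentiable[OF x] F
      by (intro bounded_linear.frechet_derivative_compose[OF bounded_linear_mult_right]) auto
    also have "frechet_derivative (\<lambda>y. b y * fundamental_form y Y Z) (at x) X =
        b x * frechet_derivative (\<lambda>y. fundamental_form y Y Z) (at x) X + \<theta> X * fundamental_form x Y Z"
      unfolding \<theta>_def
      by (rule bounded_bilinear.frechet_derivative_prod[OF bounded_bilinear_mult b_differentiable[OF x] F])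
    finally show ?thesis .
  qed
  show ?thesis using d_d_eta[OF x, of X Y Z] unfolding * d_F_def by (simp add: algebra_simps)
qed

text \<open>Where \<open>b \<noteq> 0\<close>, \<open>dF = - (db / b) \<and> F\<close>.  The horizontal part of this equation forces \<open>db\<close> to vanish on the
  horizontal space and removes the components of index \<open>1\<close> and \<open>3\<close>; the part with one argument \<open>\<zeta>\<close>
  removes those of index \<open>8\<close> and \<open>11\<close> and relates \<open>db(\<zeta>)\<close> to the factor \<open>a\<close> of \<open>B\<^sub>5\<close>.\<close>

lemma nonzero_b_consequences:
  assumes x: "x \<in> U" and b: "b x \<noteq> 0"
  obtains a where "\<And>X. X \<in> horizontal x \<Longrightarrow> frechet_derivative b (at x) X = 0"
    and "frechet_derivative b (at x) (\<zeta> x) = 2 * a * b x"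
    and "a = 0 \<Longrightarrow> \<forall>X Y. \<Xi> 5 x X Y = 0"
    and "\<forall>i\<in>{1, 3, 8, 11}. \<forall>X Y. \<Xi> i x X Y = 0"
proof -
  interpret P: almost_contact_metric_vector_space "\<phi> x" "\<zeta> x" "\<eta> x" "g x" using acm[OF x] .
  define \<theta> where "\<theta> = frechet_derivative b (at x)"
  define S where "S X Y = \<Xi> 1 x X Y + \<Xi> 2 x X Y + \<Xi> 3 x X Y" for X Y
  have \<theta>: "linear \<theta>"
    unfolding \<theta>_def using linear_frechet_derivative[OF b_differentiable[OF x]] .
  note wedge = d_b_wedge_F[OF x, folded \<theta>_def]
  note GH = GH_components[OF x]
  have hor_eq: "\<theta> X * g x Y (\<phi> x Z) + \<theta> Y * g x Z (\<phi> x X) + \<theta> Z * g x X (\<phi> x Y) =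
      - 2 * b x * (g x (S X Y) (\<phi> x Z) + g x (S Y Z) (\<phi> x X) + g x (S Z X) (\<phi> x Y))"
    if "X \<in> P.H" "Y \<in> P.H" "Z \<in> P.H" for X Y Z
    using wedge[of X Y Z] unfolding d_F_horizontal[OF x that, folded S_def] by algebra
  have \<theta>0: "\<theta> X = 0" if X: "X \<in> P.H" for X
  proof -
    have "(- 1 / (2 * b x)) *\<^sub>R \<theta> X = 0"
    proof (rule P.cyclic_eq_wedge_F_imp_zero[OF GH S_def _ dim _ X])
      show "linear (\<lambda>X. (- 1 / (2 * b x)) *\<^sub>R \<theta> X)"
        by (rule linear_compose_scale_right[OF \<theta>])
      fix X Y Z assume "X \<in> P.H" "Y \<in> P.H" "Z \<in> P.H"
      then have "g x (S X Y) (\<phi> x Z) + g x (S Y Z) (\<phi> x X) + g x (S Z X) (\<phi> x Y) =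
        (- 1 / (2 * b x)) * (\<theta> X * P.F Y Z + \<theta> Y * P.F Z X + \<theta> Z * P.F X Y)"
        unfolding P.F_def using b by (simp add: hor_eq)
      then show "g x (S X Y) (\<phi> x Z) + g x (S Y Z) (\<phi> x X) + g x (S Z X) (\<phi> x Y) =
        (- 1 / (2 * b x)) *\<^sub>R \<theta> X * P.F Y Z + (- 1 / (2 * b x)) *\<^sub>R \<theta> Y * P.F Z X +
        (- 1 / (2 * b x)) *\<^sub>R \<theta> Z * P.F X Y"
        by (simp only: ring_distribs mult.assoc real_scaleR_def)
    qed
    then show ?thesis using b by simp
  qed
  have cyc: "g x (S X Y) (\<phi> x Z) + g x (S Y Z) (\<phi> x X) + g x (S Z X) (\<phi> x Y) = 0"
    if "X \<in> P.H" "Y \<in> P.H" "Z \<in> P.H" for X Y Z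
    using hor_eq[OF that] that \<theta>0 b by simp
  have \<Xi>13: "\<Xi> 1 x X Y = 0" "\<Xi> 3 x X Y = 0" for X Y
    using P.cyclic_zero_imp_GH2[OF GH S_def cyc] by auto
  obtain a B8 where B8: "B8 \<in> P.B8_class"
    and ver: "\<And>X Y. X \<in> P.H \<Longrightarrow> Y \<in> P.H \<Longrightarrow> d_F x (\<zeta> x) X Y =
      g x X (nabla_endo g \<phi> x (\<zeta> x) Y) - 2 * a * fundamental_form x X Y - 2 * B8 X (\<phi> x Y)"
    and a: "a = 0 \<Longrightarrow> \<forall>X Y. \<Xi> 5 x X Y = 0"
    and \<Xi>8: "\<forall>X\<in>P.H. \<forall>Y\<in>P.H. B8 X Y = 0 \<Longrightarrow> \<forall>X Y. \<Xi> 8 x X Y = 0"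
    by (rule pointwise_equations[OF x]) (rule that; assumption | simp)
  let ?N = "nabla_endo g \<phi> x (\<zeta> x)"
  have N_anti: "g x (\<phi> x X) (?N (\<phi> x Y)) = - g x X (?N Y)" if "X \<in> P.H" "Y \<in> P.H" for X Y
  proof -
    have "?N (\<phi> x Y) + \<phi> x (?N Y) = nabla_form g \<eta> x (\<zeta> x) Y *\<^sub>R \<zeta> x + \<eta> x Y *\<^sub>R nabla_vector g \<zeta> x (\<zeta> x)"
      by (rule nabla_\<phi>_\<phi>[OF x])
    then have "?N (\<phi> x Y) = - \<phi> x (?N Y)"
      using that by (simp add: nabla_form_\<zeta>[OF x] P.H_iff eq_neg_iff_add_eq_0)
    then show ?thesis using that by (simp add: P.g_simps P.g_\<phi>_\<phi>_H)
  qed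
  have eq: "b x * (g x X (?N Y) - 2 * a * P.F X Y - 2 * B8 X (\<phi> x Y)) = - \<theta> (\<zeta> x) * P.F X Y"
    if "X \<in> P.H" "Y \<in> P.H" for X Y
    using wedge[of "\<zeta> x" X Y] ver[OF that] \<theta>0 that by (simp add: P.F_def)
  have "DIM('e) > 1" using dim by simp
  note vert = P.vertical_equation_imp[where N = ?N, OF B8 b this N_anti eq]
  have "\<Xi> 11 x X Y = 0" for X Y
  proof -
    have "P.hor (?N (P.hor Y)) = 0"
      using vert(1)[of _ "P.hor Y"] P.g_symmetric[of "?N (P.hor Y)"]
      by (intro P.g_nondegenerate_H) (auto simp: P.g_hor_left)
    then have "\<phi> x (?N (P.hor Y)) = 0"
      by (metis P.\<phi>_\<zeta> P.\<phi>_simps(2,4,5) P.hor_def diff_zero scaleR_zero_right)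
    then have "P.hor (intrinsic_torsion \<phi> \<zeta> \<eta> g x (\<zeta> x) (P.hor Y)) = 0"
      by (simp add: torsion_horizontal[OF x])
    moreover have "\<Xi> 11 x X Y = \<eta> x X *\<^sub>R P.hor (intrinsic_torsion \<phi> \<zeta> \<eta> g x (\<zeta> x) (P.hor Y))"
      using components[OF x] unfolding P.torsion_components_def by blast
    ultimately show ?thesis by simp
  qed
  then show ?thesis
    using that[of a] \<theta>0 a \<Xi>13 \<Xi>8 vert(2) vert(3) unfolding \<theta>_def by simp
qed

text \<open>Where \<open>b \<noteq> 0\<close>, \<open>db = f \<eta>\<close> with \<open>f = db(\<zeta>)\<close>, and \<open>0 = d(db)\<close> is \<open>f d\<eta>\<close> on the
  horizontal space, where \<open>d\<eta> = - 2 b F\<close> is nonzero.\<close>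

lemma nonzero_b_derivative:
  assumes x: "x \<in> U" and b: "b x \<noteq> 0"
  shows "frechet_derivative b (at x) X = 0"
proof -
  interpret P: almost_contact_metric_vector_space "\<phi> x" "\<zeta> x" "\<eta> x" "g x" using acm[OF x] .
  obtain V where V: "open V" "x \<in> V" "V \<subseteq> U" "\<forall>k. C_k_on k V b"
    using b_locally_C_k[OF x] .
  note b_C_k = V(4)[rule_format]
  define db where "db y Y = frechet_derivative b (at y) Y" for y Y
  \<comment> \<open>This is \<open>db(\<zeta>)\<close> near \<open>x\<close>, in a form that shows its differentiability.\<close>
  define f where "f y = db y (\<zeta> x) * inverse (\<eta> y (\<zeta> x))" for y
  have lin: "linear (db y)" if "y \<in> U" for y
    unfolding db_def[abs_def] using linear_frechet_derivative[OF b_differentiable[OF that]] .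
  have db_eq: "db y Y = \<eta> y Y * db y (\<zeta> y)" if y: "y \<in> U" "b y \<noteq> 0" for y Y
  proof -
    interpret Q: almost_contact_metric_vector_space "\<phi> y" "\<zeta> y" "\<eta> y" "g y" using acm[OF y(1)] .
    have "db y (Q.hor Y) = 0"
      unfolding db_def by (rule nonzero_b_consequences[OF y]) simp
    then show ?thesis
      using linear_diff[OF lin[OF y(1)]] linear_cmul[OF lin[OF y(1)]] by (simp add: Q.hor_def)
  qed
  define W where "W = {y \<in> V. b y * \<eta> y (\<zeta> x) \<noteq> 0}"
  have "continuous_on V (\<lambda>y. b y * \<eta> y (\<zeta> x))"
    using b_C_k[of 0] C_k_on_subset[OF C_k_\<eta>[of 0] V(3)] by (simp add: continuous_on_mult)
  then have W: "open W"
    using continuous_open_preimage[OF _ V(1), of "\<lambda>y. b y * \<eta> y (\<zeta> x)" "- {0}"]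
    unfolding W_def by (simp add: vimage_def Int_def open_Compl)
  have xW: "x \<in> W" using V b P.\<eta>_\<zeta> by (simp add: W_def)
  have WU: "W \<subseteq> U" using V(3) by (auto simp: W_def)
  have db_W: "f y * \<eta> y Y = db y Y" if "y \<in> W" for y Y
    using db_eq[of y Y] db_eq[of y "\<zeta> x"] that WU by (auto simp: f_def W_def)
  have db_diff: "(\<lambda>y. db y Y) differentiable (at x)" for Y
    using b_C_k[of 2] V(2) by (simp add: numeral_2_eq_2 db_def)
  have f_diff: "f differentiable (at x)"
    unfolding f_def using db_diff diff_\<eta>[OF x, of "\<zeta> x"] P.\<eta>_\<zeta>
    by (intro differentiable_mult differentiable_inverse) auto
  have dd: "frechet_derivative (\<lambda>y. db y Y) (at x) X =
      f x * frechet_derivative (\<lambda>y. \<eta> y Y) (at x) X + frechet_derivative f (at x) X * \<eta> x Y" for X Y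
  proof -
    have "frechet_derivative (\<lambda>y. db y Y) (at x) X = frechet_derivative (\<lambda>y. f y * \<eta> y Y) (at x) X"
      by (intro fun_cong[OF frechet_derivative_cong_open[OF W xW]]) (simp add: db_W)
    also have "\<dots> = f x * frechet_derivative (\<lambda>y. \<eta> y Y) (at x) X + frechet_derivative f (at x) X * \<eta> x Y"
      by (rule bounded_bilinear.frechet_derivative_prod[OF bounded_bilinear_mult f_diff diff_\<eta>[OF x]])
    finally show ?thesis .
  qed
  obtain X0 Y0 where XY: "X0 \<in> P.H" "Y0 \<in> P.H" "P.F X0 Y0 \<noteq> 0"
    by (rule P.F_nonzero) (use dim in auto)
  have "frechet_derivative (\<lambda>y. db y Y0) (at x) X0 = frechet_derivative (\<lambda>y. db y X0) (at x) Y0"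
    unfolding db_def by (rule second_derivative_symmetric[OF V(1,2) b_C_k])
  then have "f x * d_eta x X0 Y0 = 0"
    using XY by (simp add: dd d_eta_def P.H_iff algebra_simps)
  then have "f x = 0" using XY b by (simp add: d_eta_eq_b[OF x] P.F_def)
  then show ?thesis using db_W[OF xW, of X] by (simp add: db_def)
qed

lemma nonzero_b_torsion:
  assumes x: "x \<in> U" and b: "b x \<noteq> 0" and i: "i \<in> {1, 3, 5, 8, 11}"
  shows "\<Xi> i x X Y = 0"
proof -
  obtain a where "frechet_derivative b (at x) (\<zeta> x) = 2 * a * b x"
    and a: "a = 0 \<Longrightarrow> \<forall>X Y. \<Xi> 5 x X Y = 0"
    and others: "\<forall>i\<in>{1, 3, 8, 11}. \<forall>X Y. \<Xi> i x X Y = 0"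
    by (rule nonzero_b_consequences[OF x b]) (rule that; assumption | simp)
  then have "a = 0" using nonzero_b_derivative[OF x b] b by simp
  then show ?thesis using a others i by auto
qed

lemma zero_b_torsion:
  assumes "x \<in> U" and "b x = 0"
  shows "\<Xi> 6 x X Y = 0"
  by (rule pointwise_equations[OF assms(1)]) (use assms(2) in simp)

text \<open>The derivative \<open>2 b db\<close> of \<open>b\<^sup>2\<close> vanishes also at the zeros of \<open>b\<close>.\<close>

lemma b_zero_locally_constant:
  assumes "ball x r \<subseteq> U" and y: "y \<in> ball x r"
  shows "b y = 0 \<longleftrightarrow> b x = 0"
proof -
  have "((\<lambda>z. b z * b z) has_derivative (\<lambda>h. 0)) (at z within ball x r)" if "z \<in> ball x r" for z
  proof -
    have z: "z \<in> U" using that assms(1) by auto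
    have "(b has_derivative frechet_derivative b (at z)) (at z)"
      using b_differentiable[OF z] by (simp add: frechet_derivative_works)
    from has_derivative_mult[OF this this]
    have "((\<lambda>z. b z * b z) has_derivative
        (\<lambda>h. b z * frechet_derivative b (at z) h + frechet_derivative b (at z) h * b z)) (at z)" .
    moreover have "b z * frechet_derivative b (at z) h = 0" for h
      using nonzero_b_derivative[OF z] by (cases "b z = 0") auto
    ultimately show ?thesis by (simp add: mult.commute has_derivative_at_withinI)
  qed
  then have "b y * b y = b x * b x"
    by (rule has_derivative_zero_unique[OF convex_ball, of x r]) (use y in \<open>auto intro: le_less_trans[OF zero_le_dist]\<close>)
  then show ?thesis by auto
qed

end


section \<open>Change of charts and connectedness\<close>

context smooth_manifold
begin

lemma chart_inj_on: "c \<in> A \<Longrightarrow> inj_on (snd c) (fst c)"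
  using homeomorphic_imp_injective_map[OF chart_homeomorphic] chart_domain_open
  by (metis inf.absorb_iff2 openin_subset topspace_subtopology)

lemma transition_eq:
  "c \<in> A \<Longrightarrow> m \<in> fst c \<Longrightarrow> transition c c' (snd c m) = snd c' m"
  using chart_inj_on by (simp add: transition_def inv_into_f_f)

lemma open_overlap:
  assumes c: "c \<in> A" and c': "c' \<in> A"
  shows "open (overlap c c')"
proof -
  have "openin (subtopology M (fst c)) (fst c \<inter> fst c')"
    using chart_domain_open[OF c'] by (auto simp: openin_subtopology Int_commute)
  then have "openin (top_of_set (coords c)) (overlap c c')"
    unfolding overlap_def
    using homeomorphic_imp_open_map[OF chart_homeomorphic[OF c]] by (simp add: open_map_def)
  then show ?thesis using chart_coords_open[OF c] by (simp add: openin_open_eq)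
qed

lemma openin_chart_preimage:
  assumes c: "c \<in> A" and V: "open V"
  shows "openin M {p \<in> fst c. snd c p \<in> V}"
proof -
  have sub: "fst c \<subseteq> topspace M" using openin_subset[OF chart_domain_open[OF c]] .
  have "openin (top_of_set (coords c)) (coords c \<inter> V)" using V by (simp add: openin_open_Int)
  from openin_continuous_map_preimage[OF homeomorphic_imp_continuous_map[OF chart_homeomorphic[OF c]] this]
  have "openin (subtopology M (fst c)) {p \<in> topspace (subtopology M (fst c)). snd c p \<in> coords c \<inter> V}" .
  moreover have "{p \<in> topspace (subtopology M (fst c)). snd c p \<in> coords c \<inter> V} = {p \<in> fst c. snd c p \<in> V}"
    using sub by (auto simp: coords_def)
  ultimately show ?thesis using chart_domain_open[OF c] openin_open_subtopology by metis
qed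

text \<open>The points whose coordinates satisfy \<open>Q\<close> and those whose coordinates do not form two disjoint open
  sets that cover the manifold.\<close>

lemma connected_locally_constant_predicate:
  assumes conn: "connected_space M"
    and compat: "\<And>c c' m. c \<in> A \<Longrightarrow> c' \<in> A \<Longrightarrow> m \<in> fst c \<Longrightarrow> m \<in> fst c' \<Longrightarrow>
      Q c (snd c m) = Q c' (snd c' m)"
    and loc: "\<And>c x r y. c \<in> A \<Longrightarrow> ball x r \<subseteq> coords c \<Longrightarrow> y \<in> ball x r \<Longrightarrow> Q c y = Q c x"
  shows "(\<forall>c\<in>A. \<forall>x\<in>coords c. Q c x) \<or> (\<forall>c\<in>A. \<forall>x\<in>coords c. \<not> Q c x)"
proof -
  define E where "E v = {m \<in> topspace M. \<exists>c\<in>A. m \<in> fst c \<and> Q c (snd c m) = v}" for v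
  have "openin M (E v)" for v
  proof (subst openin_subopen, intro ballI)
    fix m assume "m \<in> E v"
    then obtain c where c: "c \<in> A" "m \<in> fst c" "Q c (snd c m) = v" unfolding E_def by blast
    then have "snd c m \<in> coords c" by (simp add: coords_def)
    then obtain r where r: "r > 0" "ball (snd c m) r \<subseteq> coords c"
      using chart_coords_open[OF c(1)] open_contains_ball by blast
    let ?T = "{p \<in> fst c. snd c p \<in> ball (snd c m) r}"
    have "openin M ?T" using openin_chart_preimage[OF c(1) open_ball] .
    moreover have "?T \<subseteq> E v"
      using loc[OF c(1) r(2)] c openin_subset[OF chart_domain_open[OF c(1)]] unfolding E_def by blast
    moreover have "m \<in> ?T" using c r by simp
    ultimately show "\<exists>T. openin M T \<and> m \<in> T \<and> T \<subseteq> E v" by blast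
  qed
  moreover have "topspace M \<subseteq> E True \<union> E False"
    unfolding E_def charts_cover[symmetric] by blast
  moreover have "E True \<inter> E False = {}" unfolding E_def using compat by blast
  ultimately have "E True = {} \<or> E False = {}"
    using conn unfolding connected_space_def by blast
  moreover have "Q c x \<noteq> v" if Ev: "E v = {}" "c \<in> A" and x: "x \<in> coords c" for c x v
  proof -
    obtain m where "m \<in> fst c" "x = snd c m" using x by (auto simp: coords_def)
    then show ?thesis
      using Ev openin_subset[OF chart_domain_open[OF Ev(2)]] unfolding E_def by blast
  qed
  ultimately show ?thesis by blast
qed

end

context almost_contact_metric_manifold
begin

lemma chart_almost_contact_metric_domain:
  assumes "c \<in> A"
  shows "almost_contact_metric_domain (coords c) (\<phi> c) (\<zeta> c) (\<eta> c) (g c)"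
  by (rule almost_contact_metric_domain.intro)
    (use assms in \<open>simp_all add: chart_coords_open pointwise smooth_\<phi> smooth_\<zeta> smooth_\<eta> smooth_g\<close>)

text \<open>The exterior derivative commutes with pull-backs: the additional term from the derivative of
  the Jacobian is a second derivative of the transition map, hence symmetric.\<close>

lemma transform_d_eta:
  assumes c: "c \<in> A" "c' \<in> A" and x: "x \<in> overlap c c'"
  defines "J \<equiv> frechet_derivative (transition c c') (at x)"
  shows "almost_contact_metric_domain.d_eta (\<eta> c') (transition c c' x) (J u) (J v) =
    almost_contact_metric_domain.d_eta (\<eta> c) x u v"
proof -
  interpret C: almost_contact_metric_domain "coords c" "\<phi> c" "\<zeta> c" "\<eta> c" "g c"
    using chart_almost_contact_metric_domain[OF c(1)] .
  interpret C': almost_contact_metric_domain "coords c'" "\<phi> c'" "\<zeta> c'" "\<eta> c'" "g c'"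
    using chart_almost_contact_metric_domain[OF c(2)] .
  let ?\<tau> = "transition c c'" and ?O = "overlap c c'"
  have O: "open ?O" by (rule open_overlap[OF c])
  have \<tau>_C_k: "C_k_on k ?O ?\<tau>" for k using charts_compatible[OF c] by (simp add: smooth_on_def)
  have \<tau>_in: "?\<tau> y \<in> coords c'" if "y \<in> ?O" for y
    using that transition_eq[OF c(1), of _ c'] by (auto simp: overlap_def coords_def)
  have \<tau>_diff: "?\<tau> differentiable (at x)" using \<tau>_C_k[of 1] x by simp
  define W where "W v y = frechet_derivative ?\<tau> (at y) v" for v y
  have W_diff: "W v differentiable (at x)" for v
    using \<tau>_C_k[of 2] x unfolding W_def[abs_def] by (simp add: numeral_2_eq_2)
  note chain = diff_chain_at[OF frechet_derivative_works[THEN iffD1, OF \<tau>_diff]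
      frechet_derivative_works[THEN iffD1, OF C'.diff_\<eta>[OF \<tau>_in[OF x]]], unfolded o_def]
  have comp_diff: "(\<lambda>y. \<eta> c' (?\<tau> y) w) differentiable (at x)" for w
    using chain unfolding differentiable_def by blast
  have D: "frechet_derivative (\<lambda>y. \<eta> c y v) (at x) u =
      frechet_derivative (\<lambda>z. \<eta> c' z (J v)) (at (?\<tau> x)) (J u) +
      \<eta> c' (?\<tau> x) (frechet_derivative (W v) (at x) u)" for u v
  proof -
    have "frechet_derivative (\<lambda>y. \<eta> c y v) (at x) u =
        frechet_derivative (\<lambda>y. \<eta> c' (?\<tau> y) (W v y)) (at x) u"
      unfolding W_def
      by (intro fun_cong[OF frechet_derivative_cong_open[OF O x]])
        (simp add: transform_\<eta>[OF c])
    also have "\<dots> = frechet_derivative (\<lambda>y. \<eta> c' (?\<tau> y) (W v x)) (at x) u +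
        \<eta> c' (?\<tau> x) (frechet_derivative (W v) (at x) u)"
      by (rule frechet_derivative_linear_apply[where \<alpha> = "\<lambda>y. \<eta> c' (?\<tau> y)", OF O x])
        (use C'.linear_\<eta> \<tau>_in W_diff comp_diff in auto)
    also have "frechet_derivative (\<lambda>y. \<eta> c' (?\<tau> y) (W v x)) (at x) u =
        frechet_derivative (\<lambda>z. \<eta> c' z (J v)) (at (?\<tau> x)) (J u)"
      using frechet_derivative_eqI[OF chain, of "J v"] by (simp add: W_def J_def)
    finally show ?thesis .
  qed
  have "frechet_derivative (W v) (at x) u = frechet_derivative (W u) (at x) v"
    unfolding W_def[abs_def] by (rule second_derivative_symmetric[OF O x \<tau>_C_k])
  then show ?thesis unfolding C.d_eta_def C'.d_eta_def D by simp
qed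

lemma transform_F:
  assumes "c \<in> A" "c' \<in> A" "x \<in> overlap c c'"
  defines "J \<equiv> frechet_derivative (transition c c') (at x)"
  shows "g c' (transition c c' x) (J u) (\<phi> c' (transition c c' x) (J v)) = g c x u (\<phi> c x v)"
  unfolding J_def by (simp add: transform_\<phi>[OF assms(1-3) refl] transform_g[OF assms(1-3) refl])

end

theorem corollary4p2:
  fixes M :: "'m topology"
    and A :: "('m, 'e::euclidean_space) chart set"
    and \<phi> :: "('m, 'e) chart \<Rightarrow> 'e \<Rightarrow> 'e \<Rightarrow> 'e"
    and \<zeta> :: "('m, 'e) chart \<Rightarrow> 'e \<Rightarrow> 'e"
    and \<eta> :: "('m, 'e) chart \<Rightarrow> 'e \<Rightarrow> 'e \<Rightarrow> real"
    and g :: "('m, 'e) chart \<Rightarrow> 'e \<Rightarrow> 'e \<Rightarrow> 'e \<Rightarrow> real"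
    and \<Xi> :: "nat \<Rightarrow> ('m, 'e) chart \<Rightarrow> 'e \<Rightarrow> 'e \<Rightarrow> 'e \<Rightarrow> 'e"
    and n :: nat
  assumes "almost_contact_metric_manifold M A \<phi> \<zeta> \<eta> g"
    and "connected_space M"
    and "DIM('e) = 2 * n + 1" and "n > 1"
    and "intrinsic_torsion_components A \<phi> \<zeta> \<eta> g \<Xi>"
    and "of_type A \<Xi> {1, 2, 3, 5, 6, 8, 9, 11}"
    and "\<not> (vanishes A (\<Xi> 5) \<and> vanishes A (\<Xi> 6))"
  shows "of_type A \<Xi> {1, 2, 3, 5, 8, 9, 11} \<or> of_type A \<Xi> {2, 6, 9}"
proof -
  interpret almost_contact_metric_manifold M A \<phi> \<zeta> \<eta> g by fact
  have zero: "\<Xi> i c x X Y = 0" if "i \<in> {4, 7, 10, 12}" "c \<in> A" "x \<in> coords c" for i c x X Y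
    using assms(6) that unfolding of_type_def vanishes_def by auto
  have dom: "torsion_type_domain (coords c) (\<phi> c) (\<zeta> c) (\<eta> c) (g c) (\<lambda>i. \<Xi> i c)" if "c \<in> A" for c
    unfolding torsion_type_domain_def torsion_type_domain_axioms_def
    using chart_almost_contact_metric_domain[OF that] assms(3-5) that zero
    by (simp add: intrinsic_torsion_components_def)
  define b where "b c = almost_contact_metric_domain.contact_coefficient (\<phi> c) (\<eta> c) (g c)" for c
  \<comment> \<open>Both \<open>d\<eta>\<close> and \<open>F\<close> are tensors, so \<open>b\<close> is a function on the manifold.\<close>
  have b_invariant: "b c (snd c m) = b c' (snd c' m)" if c: "c \<in> A" "c' \<in> A" and m: "m \<in> fst c" "m \<in> fst c'" for c c' m
  proof -
    interpret C: torsion_type_domain "coords c" "\<phi> c" "\<zeta> c" "\<eta> c" "g c" "\<lambda>i. \<Xi> i c"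
      using dom[OF c(1)] .
    interpret C': torsion_type_domain "coords c'" "\<phi> c'" "\<zeta> c'" "\<eta> c'" "g c'" "\<lambda>i. \<Xi> i c'"
      using dom[OF c(2)] .
    let ?x = "snd c m" and ?x' = "snd c' m"
    have x: "?x \<in> overlap c c'" "?x \<in> coords c" "?x' \<in> coords c'"
      using m by (auto simp: overlap_def coords_def)
    interpret P: almost_contact_metric_vector_space "\<phi> c ?x" "\<zeta> c ?x" "\<eta> c ?x" "g c ?x"
      using pointwise[OF c(1) x(2)] .
    obtain u v where uv: "P.F u v \<noteq> 0" by (rule P.F_nonzero) (use C.dim in auto)
    note \<tau> = transition_eq[OF c(1) m(1), of c']
    have "b c ?x * P.F u v = b c' ?x' * P.F u v"
      using transform_d_eta[OF c x(1), of u v] transform_F[OF c x(1), of u v]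
      by (auto simp: \<tau> C.d_eta_eq_b[OF x(2)] C'.d_eta_eq_b[OF x(3)] b_def P.F_def)
    then show ?thesis using uv by simp
  qed
  have "(\<forall>c\<in>A. \<forall>x\<in>coords c. b c x = 0) \<or> (\<forall>c\<in>A. \<forall>x\<in>coords c. b c x \<noteq> 0)"
  proof (rule connected_locally_constant_predicate[OF assms(2)])
    fix c c' m assume "c \<in> A" "c' \<in> A" "m \<in> fst c" "m \<in> fst c'"
    then show "(b c (snd c m) = 0) = (b c' (snd c' m) = 0)" by (simp only: b_invariant[of c c' m])
  next
    fix c x r y assume "c \<in> A" "ball x r \<subseteq> coords c" "y \<in> ball x r"
    then show "(b c y = 0) = (b c x = 0)"
      unfolding b_def by (rule torsion_type_domain.b_zero_locally_constant[OF dom])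
  qed
  then show ?thesis
  proof
    assume b: "\<forall>c\<in>A. \<forall>x\<in>coords c. b c x = 0"
    have "\<Xi> i c x X Y = 0" if "i \<in> {1..12} - {1, 2, 3, 5, 8, 9, 11}" "c \<in> A" "x \<in> coords c" for i c x X Y
    proof -
      have "i = 6 \<or> i \<in> {4, 7, 10, 12}" using that(1) by simp presburger
      then show ?thesis
        using zero that(2,3) torsion_type_domain.zero_b_torsion[OF dom] b unfolding b_def by blast
    qed
    then show ?thesis unfolding of_type_def vanishes_def by blast
  next
    assume b: "\<forall>c\<in>A. \<forall>x\<in>coords c. b c x \<noteq> 0"
    have "\<Xi> i c x X Y = 0" if "i \<in> {1..12} - {2, 6, 9}" "c \<in> A" "x \<in> coords c" for i c x X Y
    proof -
      have "i \<in> {1, 3, 5, 8, 11} \<or> i \<in> {4, 7, 10, 12}" using that(1) by simp presburger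
      then show ?thesis
        using zero[OF _ that(2,3)] b that(2,3)
          torsion_type_domain.nonzero_b_torsion[OF dom[OF that(2)] that(3), of i, folded b_def]
        by blast
    qed
    then show ?thesis unfolding of_type_def vanishes_def by blast
  qed
qed

end
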